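(* Suppose that $X,X_1,X_2,\ldots$ are i.i.d. random variables with mean $0$ and let $T_{n,n+k}=\sum_{j=n+1}^{n+k}X_j$. If $\sigma^2=\operatorname{Var}X<\infty$, then for any integer $m\ge2$, $$\limsup_{n\to\infty}\frac{T_{n,n+n/\log_m(n)}}{\sqrt{2\,\big(n/\log_m(n)\big)\log\log n}}=\sigma\quad\text{a.s.}$$
   Context: Here $\log_m(x)$ denotes the $m$-times iterated natural logarithm ($\log_1 x=\log x$, $\log_{m+1}x=\log(\log_m x)$), considered for $x$ sufficiently large. Window lengths are rounded to integers: $T_{n,n+a}$ with non-integer $a$ means $T_{n,n+[a]}$, where $[\cdot]$ is the integer part. *)

theory Defs
  imports "HOL-Probability.Probability"
begin

text \<open>\<open>iter_log m x\<close> is $\log_m(x)$. Since \<open>ln\<close> is total, the value is meaningful only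
  for \<open>x\<close> so large (depending on \<open>m\<close>) that the inner logarithms are positive.\<close>

definition iter_log :: "nat \<Rightarrow> real \<Rightarrow> real" where
  "iter_log m x = (ln ^^ m) x"

text \<open>\<open>delayed_sum X n N\<close> is $T_{n,N} = X_{n+1} + \dots + X_N$.\<close>

definition delayed_sum :: "(nat \<Rightarrow> 'a \<Rightarrow> real) \<Rightarrow> nat \<Rightarrow> nat \<Rightarrow> 'a \<Rightarrow> real" where
  "delayed_sum X n N \<omega> = (\<Sum>j = n + 1..N. X j \<omega>)"

text \<open>\<open>iid_copies M Y X\<close>: the variables $X_1, X_2, \dots$ are independent, each with the
  distribution of the generic variable \<open>Y\<close>. Independence of \<open>Y\<close> from the sequence is not
  required, so that \<open>Y\<close> may be one of the \<open>X j\<close>; the entry \<open>X 0\<close> is unconstrained.\<close>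

definition iid_copies :: "'a measure \<Rightarrow> ('a \<Rightarrow> real) \<Rightarrow> (nat \<Rightarrow> 'a \<Rightarrow> real) \<Rightarrow> bool" where
  "iid_copies M Y X \<longleftrightarrow>
     Y \<in> borel_measurable M \<and>
     prob_space.indep_vars M (\<lambda>_. borel) X {1..} \<and>
     (\<forall>j\<ge>1. distr M borel (X j) = distr M borel Y)"

end

theory Submission
  imports Defs "HOL-Real_Asymp.Real_Asymp"
begin

text \<open>
  Write $L = \log_m$, $a_n = n / L(n)$ and $\ell_n = \log\log n$.  The windows have to be compared
  with $\sqrt{2 a_n \ell_n}$, as if every one of them obeyed the law of the iterated logarithm with
  the \<^emph>\<open>outer\<close> time $n$: between $2^k$ and $2^{k+1}$ there are about $L(2^k)$ essentially
  different windows, and as $L \le \log\log$ this number is too small to compete with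
  $e^{-\ell_n} \approx 1 / k$.  The only properties of $L$ that enter are collected in the locale
  \<open>slow_scale\<close>.

  \<^bold>\<open>Lower bound\<close> (\<open>delayed_sum_frequently_ge\<close>).  The windows starting at $n = 2^k$ are disjoint
  for large $k$, so by the second Borel-Cantelli lemma it suffices that the probability of exceeding
  $(1-\epsilon)\sigma\sqrt{2 a_n \ell_n}$ is at least a constant times $e^{-(1-\epsilon/2)\ell_n}$,
  which is of order at least $1/k$.  For this a window is cut into about $\ell_n / K$ pieces, and every
  piece is asked to contribute its share.  A piece has to exceed a fixed multiple
  (about $\sqrt{2K}$) of its standard deviation, so the central limit theorem bounds its probability
  from below by $e^{-(1-\epsilon/2)K}$ if $K$ is large; the pieces are independent
  (\<open>tail_moderate_deviation\<close>).

  \<^bold>\<open>Upper bound\<close> (\<open>AE_delayed_sum_le\<close>).  At scale $k$ put $N = 2^k$, $A = N / L(N)$,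
  $\ell = \log\log N$ and split every $X_j$ at the two levels $b = \eta\sqrt{A / \ell}$ and
  $c = \sqrt N$.

  \<^item> Values above $c$ occur only finitely often since $E X^2 < \infty$ (\<open>AE_eventually_small\<close>).

  \<^item> The part below $b$ has Gaussian exponential moments in the relevant range.  A
    maximal inequality (\<open>maximal_exponential_inequality\<close>) treats all windows that start in a block
    of length $\delta A$ at once, and there are about $L(N)/\delta$ such blocks at scale $k$.
    A block fails with probability at most $2 e^{-(1+\epsilon)\ell}$, and $L(N) e^{-(1+\epsilon)\ell}$
    is summable over $k$ (\<open>trunc_block_tail\<close>, \<open>summable_lnln\<close>).

  \<^item> The middle part is the delicate one: no moment above the second is available, and its
    contribution is small only on the average over the scales.  Its fourth central moment is bounded
    through $w_k = E[|X|^3; |X| \le c] / c$, and Markov's inequality gives a failure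
    probability $O(w_k / \ell)$ for one block (\<open>mid_block_tail\<close>).  Since there are
    $O(\ell)$ blocks, scale $k$ fails with probability $O(w_k)$, and $\sum_k w_k$ is at most a
    constant times $E X^2$ (\<open>summable_w\<close>).

  The case $\sigma = 0$ is degenerate and is treated directly.
\<close>

section \<open>Slowly growing scales and iterated logarithms\<close>

text \<open>
  All that the limit law needs to know about the divisor $\log_m$ of the window length: it is
  unbounded, so that windows are short compared with $n$; it hardly changes within a
  dyadic scale; and it does not exceed $\log\log$, which bounds the number of windows per scale.
\<close>

locale slow_scale =
  fixes L :: "real \<Rightarrow> real"
  assumes L_at_top: "filterlim L at_top at_top"
    and L_eventually_mono: "\<exists>x0. mono_on {x0..} L"
    and L_double: "eventually (\<lambda>x. L (2 * x) \<le> L x + 1) at_top"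
    and L_le_lnln: "eventually (\<lambda>x. L x \<le> ln (ln x)) at_top"
begin

text \<open>
  Three doublings cost at most an additive $3$, which is relatively negligible because
  $L \to \infty$.  The factor 8 lets one scale $2^k$ see everything from $2^k/2$ to $4 \cdot 2^k$.
\<close>

lemma L_nearly_constant:
  assumes "\<epsilon> > 0"
  shows "eventually (\<lambda>z. \<forall>x y. z \<le> x \<longrightarrow> x \<le> y \<longrightarrow> y \<le> 8 * z \<longrightarrow> L x \<le> L y \<and> L y \<le> (1 + \<epsilon>) * L x) at_top"
proof -
  obtain x0 where x0: "mono_on {x0..} L" using L_eventually_mono by blast
  obtain x1 where x1: "\<And>x. x \<ge> x1 \<Longrightarrow> L (2 * x) \<le> L x + 1"
    using L_double by (auto simp: eventually_at_top_linorder)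
  have "eventually (\<lambda>z. L z \<ge> 3 / \<epsilon>) at_top"
    using L_at_top by (auto simp: filterlim_at_top)
  moreover have "eventually (\<lambda>z. z \<ge> max (max x0 x1) 0) at_top"
    by (rule eventually_ge_at_top)
  ultimately show ?thesis
  proof eventually_elim
    case (elim z)
    show ?case
    proof (intro allI impI)
      fix x y assume xy: "z \<le> x" "x \<le> y" "y \<le> 8 * z"
      have m: "L u \<le> L v" if "z \<le> u" "u \<le> v" for u v
        using x0 that elim by (auto simp: mono_on_def)
      have "L y \<le> L (8 * z)" using m xy by simp
      also have "L (8 * z) \<le> L z + 3"
        using x1[of z] x1[of "2 * z"] x1[of "4 * z"] elim by simp
      also have "L z \<le> L x" using m xy by simp
      finally have "L y \<le> L x + 3" by simp
      also have "3 \<le> \<epsilon> * L x"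
      proof -
        have "3 / \<epsilon> \<le> L x" using elim \<open>L z \<le> L x\<close> by simp
        then show ?thesis using assms by (simp add: field_simps)
      qed
      finally show "L x \<le> L y \<and> L y \<le> (1 + \<epsilon>) * L x" using m xy by (simp add: algebra_simps)
    qed
  qed
qed

end

lemma iter_log_Suc: "iter_log (Suc m) x = ln (iter_log m x)"
  by (simp add: iter_log_def)

lemma iter_log_at_top: "filterlim (iter_log m) at_top at_top"
proof (induction m)
  case 0 then show ?case by (simp add: iter_log_def filterlim_ident)
next
  case (Suc m)
  show ?case
    unfolding iter_log_Suc[abs_def] using filterlim_compose[OF ln_at_top Suc] by simp
qed

lemma iter_log_eventually_mono: "\<exists>x0. mono_on {x0..} (iter_log m)"
proof (induction m)
  case 0 then show ?case by (auto simp: iter_log_def mono_on_def)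
next
  case (Suc m)
  then obtain x0 where x0: "mono_on {x0..} (iter_log m)" by blast
  obtain x1 where x1: "\<And>x. x \<ge> x1 \<Longrightarrow> iter_log m x \<ge> 1"
    using iter_log_at_top[of m] by (auto simp: filterlim_at_top eventually_at_top_linorder)
  have "iter_log (Suc m) x \<le> iter_log (Suc m) y" if "max x0 x1 \<le> x" "x \<le> y" for x y
    using x0 x1[of x] that unfolding iter_log_Suc by (intro ln_mono) (auto simp: mono_on_def)
  then show ?case by (auto simp: mono_on_def intro!: exI[of _ "max x0 x1"])
qed

text \<open>
  Each further logarithm turns an additive error 1 at a value $y \ge 1$ into
  $\log (1 + 1/y) \le 1$.
\<close>

lemma iter_log_double:
  assumes "m \<ge> 1"
  shows "eventually (\<lambda>x. iter_log m (2 * x) \<le> iter_log m x + 1) at_top"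
  using assms
proof (induction m rule: nat_induct_at_least)
  case base
  have "iter_log 1 (2 * x) \<le> iter_log 1 x + 1" if "x \<ge> 1" for x
    using that ln_2_less_1 by (simp add: iter_log_def ln_mult)
  then show ?case by (auto simp: eventually_at_top_linorder)
next
  case (Suc m)
  have g: "eventually (\<lambda>x. iter_log m x \<ge> 1) at_top"
    using iter_log_at_top[of m] by (auto simp: filterlim_at_top)
  have "filterlim (\<lambda>x::real. 2 * x) at_top at_top"
    by (rule filterlim_tendsto_pos_mult_at_top[OF tendsto_const]) (auto simp: filterlim_ident)
  then have g2: "eventually (\<lambda>x. iter_log m (2 * x) \<ge> 1) at_top"
    using g by (auto simp: filterlim_iff)
  show ?case using Suc.IH g g2
  proof eventually_elim
    case (elim x)
    define y where "y = iter_log m x"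
    have "ln (iter_log m (2 * x)) \<le> ln (y * (1 + 1 / y))"
    proof (rule ln_mono)
      have "y * (1 + 1 / y) = y + 1" using elim by (simp add: y_def distrib_left)
      then show "iter_log m (2 * x) \<le> y * (1 + 1 / y)" using elim by (simp add: y_def)
    qed (use elim in auto)
    also have "\<dots> = ln y + ln (1 + 1 / y)"
    proof (rule ln_mult_pos)
      show "1 + 1 / y > 0" using elim by (intro add_pos_nonneg) (auto simp: y_def)
    qed (use elim in \<open>auto simp: y_def\<close>)
    also have "ln (1 + 1 / y) \<le> 1 / y"
      using elim by (intro ln_add_one_self_le_self) (auto simp: y_def)
    also have "1 / y \<le> 1" using elim by (simp add: y_def)
    finally show ?case by (simp add: iter_log_Suc y_def)
  qed
qed

lemma iter_log_le_lnln:
  assumes "m \<ge> 2"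
  shows "eventually (\<lambda>x. iter_log m x \<le> ln (ln x)) at_top"
  using assms
proof (induction m rule: nat_induct_at_least)
  case base
  then show ?case by (simp add: iter_log_def numeral_2_eq_2)
next
  case (Suc m)
  have g: "eventually (\<lambda>x. iter_log m x \<ge> 1) at_top"
    using iter_log_at_top[of m] by (auto simp: filterlim_at_top)
  show ?case using Suc.IH g
  proof eventually_elim
    case (elim x)
    then have "ln (iter_log m x) \<le> iter_log m x - 1" by (intro ln_le_minus_one) auto
    then show ?case using elim by (simp add: iter_log_Suc)
  qed
qed

lemma slow_scale_iter_log:
  assumes "m \<ge> 2"
  shows "slow_scale (iter_log m)"
  using assms iter_log_at_top iter_log_eventually_mono iter_log_double iter_log_le_lnln
  by unfold_locales auto

text \<open>
  With $\ell = \log\log 2^k$ one has $e^{-\ell} = 1 / (k \log 2)$; the factor $\ell$ is absorbed by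
  half of the surplus exponent $\epsilon$.
\<close>

lemma summable_lnln:
  fixes \<epsilon> :: real
  assumes "\<epsilon> > 0"
  shows "summable (\<lambda>k. ln (ln (2 ^ k)) * exp (- (1 + \<epsilon>) * ln (ln (2 ^ k))))"
proof (rule summable_comparison_test_ev)
  define p where "p = 1 + \<epsilon> / 2"
  show "summable (\<lambda>k. 2 / \<epsilon> * ln 2 powr (- p) * real k powr (- p))"
    using assms by (intro summable_mult) (simp add: summable_real_powr_iff p_def)
  have "eventually (\<lambda>k. ln (ln (2 ^ k)) \<ge> (1::real)) sequentially" by real_asymp
  then show "eventually (\<lambda>k. norm (ln (ln (2 ^ k)) * exp (- (1 + \<epsilon>) * ln (ln (2 ^ k))))
      \<le> 2 / \<epsilon> * ln 2 powr (- p) * real k powr (- p)) sequentially"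
    using eventually_gt_at_top[of 0]
  proof eventually_elim
    case (elim k)
    define l where "l = ln (ln (2 ^ k) :: real)"
    have l: "l \<ge> 1" using elim by (simp add: l_def)
    have "\<epsilon> / 2 * l \<le> exp (\<epsilon> / 2 * l)" using exp_ge_add_one_self[of "\<epsilon> / 2 * l"] by linarith
    then have "l \<le> 2 / \<epsilon> * exp (\<epsilon> / 2 * l)" using assms by (simp add: field_simps)
    then have "l * exp (- (1 + \<epsilon>) * l) \<le> 2 / \<epsilon> * exp (\<epsilon> / 2 * l) * exp (- (1 + \<epsilon>) * l)"
      by (intro mult_right_mono) auto
    also have "\<dots> = 2 / \<epsilon> * exp (- p * l)" by (simp add: exp_add[symmetric] p_def algebra_simps)
    also have "exp (- p * l) = (real k * ln 2) powr (- p)"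
      using elim by (simp add: powr_def l_def ln_realpow)
    also have "\<dots> = ln 2 powr (- p) * real k powr (- p)" using elim by (subst powr_mult) (auto simp: mult.commute)
    finally show ?case using l by (simp add: l_def[symmetric] mult.assoc)
  qed
qed

lemma exp_le_quadratic: "exp (y::real) \<le> 1 + y + y\<^sup>2 / 2 * exp \<bar>y\<bar>"
proof -
  obtain t where t: "\<bar>t\<bar> \<le> \<bar>y\<bar>" "exp y = (\<Sum>m<2. y ^ m / fact m) + exp t / fact 2 * y ^ 2"
    using Maclaurin_exp_le[of y 2] by blast
  have "exp t * y\<^sup>2 \<le> exp \<bar>y\<bar> * y\<^sup>2" using t(1) by (intro mult_right_mono) auto
  then show ?thesis unfolding t(2) by (simp add: numeral_2_eq_2 field_simps)
qed

text \<open>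
  Only the powers $q^k \ge y$ contribute, so this is the tail of a geometric series, comparable to
  its first term.
\<close>

lemma truncated_geometric_sum:
  fixes q y :: real
  assumes q: "q > 1" and y: "y > 0"
  shows "(\<Sum>k<K. if y \<le> q ^ k then 1 / q ^ k else 0) \<le> (q / (q - 1)) / y"
proof -
  define C where "C = q / (q - 1)"
  have C: "C > 0" using q by (simp add: C_def)
  \<comment> \<open>the subtracted term is what the rest of the geometric series can still contribute\<close>
  have "(\<Sum>k<K. if y \<le> q ^ k then 1 / q ^ k else 0) \<le> (if y \<le> q ^ K then C / y - C / q ^ K else 0)"
  proof (induction K)
    case 0
    have "y \<le> 1 \<Longrightarrow> C \<le> C / y" using C y by (simp add: field_simps)
    then show ?case by simp
  next
    case (Suc K)
    have qK: "q ^ K > 0" using q by simp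
    show ?case
    proof (cases "y \<le> q ^ K")
      case True
      have "q ^ K \<le> q ^ Suc K" using q by (intro power_increasing) auto
      with True have yS: "y \<le> q ^ Suc K" by linarith
      have "C * (q - 1) = q" using q by (simp add: C_def)
      moreover have "C / q ^ K - C / q ^ Suc K = (C * (q - 1)) / q ^ Suc K" using q qK by (simp add: field_simps)
      ultimately have "1 / q ^ K = C / q ^ K - C / q ^ Suc K" using q by simp
      then show ?thesis using Suc True yS by (simp del: power_Suc)
    next
      case False
      have "C / q ^ Suc K \<le> C / y" if "y \<le> q ^ Suc K"
        using that C y by (intro divide_left_mono) auto
      moreover have "(\<Sum>k<K. if y \<le> q ^ k then 1 / q ^ k else 0) \<le> 0" using Suc False by simp
      ultimately show ?thesis using False by (auto simp del: power_Suc)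
    qed
  qed
  also have "\<dots> \<le> C / y" using C y q by (auto intro!: divide_nonneg_pos)
  finally show ?thesis by (simp add: C_def)
qed

section \<open>Inequalities for sums of independent variables\<close>

lemma (in prob_space) indep_var_of_block:
  fixes Z :: "nat \<Rightarrow> 'a \<Rightarrow> real"
  assumes ind: "indep_vars (\<lambda>_. borel) Z (I \<union> {j})" and "j \<notin> I"
    and v: "v \<in> borel_measurable (PiM I (\<lambda>_. borel))"
    and w: "w \<in> borel_measurable borel"
  shows "indep_var borel (\<lambda>\<omega>. v (restrict (\<lambda>i. Z i \<omega>) I)) borel (\<lambda>\<omega>. w (Z j \<omega>) :: real)"
proof -
  have "indep_var borel (v \<circ> (\<lambda>\<omega>. restrict (\<lambda>i. Z i \<omega>) I))
      borel ((\<lambda>f. w (f j)) \<circ> (\<lambda>\<omega>. restrict (\<lambda>i. Z i \<omega>) {j}))"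
    using w assms(2) v by (intro indep_var_compose[OF indep_var_restrict[OF ind]]) auto
  then show ?thesis by (simp add: comp_def)
qed

text \<open>
  Doob's inequality for the exponential of the partial sums, in the form that accepts a common bound
  \<open>\<phi>\<close> on the exponential moments instead of centred variables.  The induction runs over the process
  that is frozen at the value $e^{tx}$ as soon as a partial sum has reached $x$.
\<close>

lemma (in prob_space) maximal_exponential_inequality:
  fixes Z :: "nat \<Rightarrow> 'a \<Rightarrow> real"
  assumes ind: "indep_vars (\<lambda>_. borel) Z {s<..s + n}"
    and int: "\<And>i. i \<in> {s<..s + n} \<Longrightarrow> integrable M (\<lambda>\<omega>. exp (t * Z i \<omega>))"
    and le: "\<And>i. i \<in> {s<..s + n} \<Longrightarrow> expectation (\<lambda>\<omega>. exp (t * Z i \<omega>)) \<le> \<phi>"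
    and \<phi>: "\<phi> \<ge> 1" and t: "t \<ge> 0"
  shows "prob {\<omega> \<in> space M. \<exists>i\<le>n. x \<le> (\<Sum>j\<in>{s<..s + i}. Z j \<omega>)} \<le> exp (- t * x) * \<phi> ^ n"
proof -
  have [measurable]: "Z i \<in> borel_measurable M" if "i \<in> {s<..s + n}" for i
    using ind that by (auto simp: indep_vars_def2)
  have S_meas: "(\<lambda>\<omega>. \<Sum>j\<in>{s<..s + i}. Z j \<omega>) \<in> borel_measurable M" if "i \<le> n" for i
    using that by (intro borel_measurable_sum) auto
  define B where "B i \<omega> \<longleftrightarrow> (\<exists>l\<le>i. x \<le> (\<Sum>j\<in>{s<..s + l}. Z j \<omega>))" for i \<omega>
  have B_meas: "{\<omega> \<in> space M. B i \<omega>} \<in> sets M" if "i \<le> n" for i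
  proof -
    have "{\<omega> \<in> space M. B i \<omega>} = (\<Union>l\<in>{..i}. {\<omega> \<in> space M. x \<le> (\<Sum>j\<in>{s<..s + l}. Z j \<omega>)})"
      by (auto simp: B_def)
    also have "\<dots> \<in> sets M"
    proof (intro sets.finite_UN)
      fix l assume "l \<in> {..i}"
      then have [measurable]: "(\<lambda>\<omega>. \<Sum>j\<in>{s<..s + l}. Z j \<omega>) \<in> borel_measurable M"
        using that by (intro S_meas) auto
      show "{\<omega> \<in> space M. x \<le> (\<Sum>j\<in>{s<..s + l}. Z j \<omega>)} \<in> sets M"
        by measurable
    qed auto
    finally show ?thesis .
  qed
  \<comment> \<open>\<open>G\<close> is the frozen part of the process and \<open>V\<close> the part that has not yet reached $x$\<close>
  define G where "G i \<omega> = (if B i \<omega> then exp (t * x) else 0)" for i \<omega>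
  define V where "V i \<omega> = (if B i \<omega> then 0 else exp (t * (\<Sum>j\<in>{s<..s + i}. Z j \<omega>)))" for i \<omega>
  have G_int: "integrable M (G i)" if "i \<le> n" for i
  proof -
    have "G i = (\<lambda>\<omega>. if B i \<omega> then exp (t * x) else 0)" by (simp add: G_def fun_eq_iff)
    moreover have "\<dots> \<in> borel_measurable M"
      using B_meas[OF that] by (intro measurable_If) auto
    ultimately show ?thesis
      by (intro integrable_const_bound[where B = "exp (t * x)"]) (auto simp: G_def)
  qed
  have main: "integrable M (V i) \<and> expectation (\<lambda>\<omega>. G i \<omega> + V i \<omega>) \<le> \<phi> ^ i" if "i \<le> n" for i
    using that
  proof (induction i)
    case 0
    have "expectation (\<lambda>\<omega>. G 0 \<omega> + V 0 \<omega>) \<le> expectation (\<lambda>_. 1)"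
    proof (rule integral_mono')
      show "G 0 \<omega> + V 0 \<omega> \<le> 1" for \<omega>
        using t by (auto simp: G_def V_def B_def mult_nonneg_nonpos)
    qed auto
    moreover have "V 0 = (\<lambda>_. if x \<le> 0 then 0 else 1)" by (auto simp: V_def B_def)
    ultimately show ?case by (simp add: prob_space)
  next
    case (Suc i)
    define v where "v f = (if \<exists>l\<le>i. x \<le> (\<Sum>j\<in>{s<..s + l}. f j) then 0 else exp (t * (\<Sum>j\<in>{s<..s + i}. f j)))"
      for f :: "nat \<Rightarrow> real"
    have v_meas: "v \<in> borel_measurable (PiM {s<..s + i} (\<lambda>_. borel))"
    proof -
      have P_meas: "(\<lambda>f::nat \<Rightarrow> real. \<Sum>j\<in>{s<..s + l}. f j) \<in> borel_measurable (PiM {s<..s + i} (\<lambda>_. borel))"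
        if "l \<le> i" for l
        using that by (intro borel_measurable_sum measurable_component_singleton) auto
      have 1: "{f \<in> space (PiM {s<..s + i} (\<lambda>_. borel)). \<exists>l\<le>i. x \<le> (\<Sum>j\<in>{s<..s + l}. f j)} =
        (\<Union>l\<in>{..i}. {f \<in> space (PiM {s<..s + i} (\<lambda>_. borel)). x \<le> (\<Sum>j\<in>{s<..s + l}. f j)})"
        by auto
      have 2: "{f \<in> space (PiM {s<..s + i} (\<lambda>_. borel)). \<exists>l\<le>i. x \<le> (\<Sum>j\<in>{s<..s + l}. f j)} \<in> sets (PiM {s<..s + i} (\<lambda>_. borel))"
        unfolding 1
      proof (intro sets.finite_UN)
        fix l assume "l \<in> {..i}"
        then have [measurable]: "(\<lambda>f::nat \<Rightarrow> real. \<Sum>j\<in>{s<..s + l}. f j) \<in> borel_measurable (PiM {s<..s + i} (\<lambda>_. borel))"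
          by (intro P_meas) auto
        show "{f \<in> space (PiM {s<..s + i} (\<lambda>_. borel)). x \<le> (\<Sum>j\<in>{s<..s + l}. f j)} \<in> sets (PiM {s<..s + i} (\<lambda>_. borel))"
          by measurable
      qed auto
      show ?thesis unfolding v_def
        by (intro measurable_If 2) (auto intro: P_meas)
    qed
    have sub: "indep_vars (\<lambda>_. borel) Z ({s<..s + i} \<union> {s + Suc i})"
      by (rule indep_vars_subset[OF ind]) (use Suc.prems in auto)
    have iv: "indep_var borel (\<lambda>\<omega>. v (restrict (\<lambda>i. Z i \<omega>) {s<..s + i})) borel (\<lambda>\<omega>. exp (t * Z (s + Suc i) \<omega>))"
      by (rule indep_var_of_block[OF sub _ v_meas, where w = "\<lambda>z. exp (t * z)"]) auto
    have vV: "v (restrict (\<lambda>i. Z i \<omega>) {s<..s + i}) = V i \<omega>" for \<omega>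
    proof -
      have "(\<Sum>j\<in>{s<..s + l}. restrict (\<lambda>i. Z i \<omega>) {s<..s + i} j) = (\<Sum>j\<in>{s<..s + l}. Z j \<omega>)" if "l \<le> i" for l
        using that by (intro sum.cong) auto
      then show ?thesis by (auto simp: v_def V_def B_def)
    qed
    note iv = iv[unfolded vV]
    have IH: "integrable M (V i)" "expectation (\<lambda>\<omega>. G i \<omega> + V i \<omega>) \<le> \<phi> ^ i"
      using Suc by auto
    have e_int: "integrable M (\<lambda>\<omega>. exp (t * Z (s + Suc i) \<omega>))"
      using Suc.prems by (intro int) auto
    have P_int: "integrable M (\<lambda>\<omega>. V i \<omega> * exp (t * Z (s + Suc i) \<omega>))"
      by (rule indep_var_integrable[OF iv IH(1) e_int])
    have sumS: "(\<Sum>j\<in>{s<..s + Suc i}. Z j \<omega>) = (\<Sum>j\<in>{s<..s + i}. Z j \<omega>) + Z (s + Suc i) \<omega>" for \<omega>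
    proof -
      have "{s<..s + Suc i} = insert (s + Suc i) {s<..s + i}" by auto
      then show ?thesis by simp
    qed
    \<comment> \<open>paths that cross $x$ in this step are lowered to $e^{tx}$ when they are frozen\<close>
    have pw: "G (Suc i) \<omega> + V (Suc i) \<omega> \<le> G i \<omega> + V i \<omega> * exp (t * Z (s + Suc i) \<omega>)" for \<omega>
    proof (cases "B i \<omega>")
      case True
      then have "B (Suc i) \<omega>" unfolding B_def using le_Suc_eq by blast
      with True show ?thesis by (simp add: G_def V_def)
    next
      case False
      have VZ: "V i \<omega> * exp (t * Z (s + Suc i) \<omega>) = exp (t * (\<Sum>j\<in>{s<..s + Suc i}. Z j \<omega>))"
        unfolding sumS using False by (simp add: V_def distrib_left exp_add)
      show ?thesis
      proof (cases "B (Suc i) \<omega>")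
        case True
        then have "x \<le> (\<Sum>j\<in>{s<..s + Suc i}. Z j \<omega>)" using False unfolding B_def by (auto simp: le_Suc_eq)
        then have "t * x \<le> t * (\<Sum>j\<in>{s<..s + Suc i}. Z j \<omega>)" by (rule mult_left_mono[OF _ t])
        with True False show ?thesis unfolding VZ by (simp add: G_def V_def del: sum.cl_ivl_Suc)
      next
        case F2: False
        with False show ?thesis unfolding VZ by (simp add: G_def V_def)
      qed
    qed
    have V_int: "integrable M (V (Suc i))"
    proof (rule Bochner_Integration.integrable_bound[OF Bochner_Integration.integrable_add[OF G_int P_int]])
      show "V (Suc i) \<in> borel_measurable M" unfolding V_def
        using B_meas[of "Suc i"] S_meas[of "Suc i"] Suc.prems by (intro measurable_If) auto
      show "AE \<omega> in M. norm (V (Suc i) \<omega>) \<le> norm (G i \<omega> + V i \<omega> * exp (t * Z (s + Suc i) \<omega>))"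
      proof (rule AE_I2)
        fix \<omega>
        have "0 \<le> V (Suc i) \<omega>" "0 \<le> G (Suc i) \<omega>" by (auto simp: V_def G_def)
        then show "norm (V (Suc i) \<omega>) \<le> norm (G i \<omega> + V i \<omega> * exp (t * Z (s + Suc i) \<omega>))"
          using pw[of \<omega>] by simp
      qed
    qed (use Suc.prems in simp)
    have Gi: "integrable M (G i)" using G_int Suc.prems by simp
    have "expectation (\<lambda>\<omega>. G (Suc i) \<omega> + V (Suc i) \<omega>) \<le> expectation (\<lambda>\<omega>. G i \<omega> + V i \<omega> * exp (t * Z (s + Suc i) \<omega>))"
      using pw Gi P_int V_int G_int Suc.prems by (intro integral_mono) auto
    also have "\<dots> = expectation (G i) + expectation (V i) * expectation (\<lambda>\<omega>. exp (t * Z (s + Suc i) \<omega>))"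
      by (subst Bochner_Integration.integral_add[OF Gi P_int], subst indep_var_lebesgue_integral[OF iv IH(1) e_int]) simp
    also have "\<dots> \<le> expectation (G i) * \<phi> + expectation (V i) * \<phi>"
    proof (intro add_mono mult_left_mono)
      have "0 \<le> expectation (G i)" by (intro Bochner_Integration.integral_nonneg) (auto simp: G_def)
      then show "expectation (G i) \<le> expectation (G i) * \<phi>" using \<phi> by (simp add: mult_left_mono mult_le_cancel_left1)
      show "0 \<le> expectation (V i)" by (intro Bochner_Integration.integral_nonneg) (auto simp: V_def)
      show "expectation (\<lambda>\<omega>. exp (t * Z (s + Suc i) \<omega>)) \<le> \<phi>" using Suc.prems by (intro le) auto
    qed
    also have "\<dots> = expectation (\<lambda>\<omega>. G i \<omega> + V i \<omega>) * \<phi>"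
      by (subst Bochner_Integration.integral_add[OF Gi IH(1)]) (simp add: distrib_right)
    also have "\<dots> \<le> \<phi> ^ i * \<phi>" using IH(2) \<phi> by (intro mult_right_mono) auto
    finally show ?case using V_int by (simp add: mult.commute)
  qed
  have "exp (t * x) * prob {\<omega> \<in> space M. B n \<omega>} = expectation (\<lambda>\<omega>. exp (t * x) * indicator {\<omega> \<in> space M. B n \<omega>} \<omega>)"
    using B_meas[of n] by simp
  also have "\<dots> \<le> expectation (\<lambda>\<omega>. G n \<omega> + V n \<omega>)"
  proof (rule integral_mono)
    show "integrable M (\<lambda>\<omega>. exp (t * x) * indicator {\<omega> \<in> space M. B n \<omega>} \<omega>)"
      using B_meas[of n] by (intro integrable_mult_right integrable_real_indicator) (auto simp: emeasure_eq_measure)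
    show "integrable M (\<lambda>\<omega>. G n \<omega> + V n \<omega>)" using main[of n] G_int[of n] by simp
    show "exp (t * x) * indicator {\<omega> \<in> space M. B n \<omega>} \<omega> \<le> G n \<omega> + V n \<omega>" for \<omega>
      by (auto simp: G_def V_def indicator_def)
  qed
  also have "\<dots> \<le> \<phi> ^ n" using main[of n] by simp
  finally have "prob {\<omega> \<in> space M. B n \<omega>} \<le> exp (- t * x) * \<phi> ^ n"
    by (simp add: exp_minus field_simps)
  then show ?thesis by (simp add: B_def)
qed

text \<open>
  In the expansion of the fourth power all terms with an isolated factor vanish; there remain the
  $n$ fourth powers and the pairs of squares.
\<close>

lemma (in prob_space) fourth_moment_sum:
  fixes Z :: "nat \<Rightarrow> 'a \<Rightarrow> real"
  assumes ind: "indep_vars (\<lambda>_. borel) Z {s<..s + n}"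
    and bd: "\<And>i \<omega>. i \<in> {s<..s + n} \<Longrightarrow> \<bar>Z i \<omega>\<bar> \<le> K"
    and mean: "\<And>i. i \<in> {s<..s + n} \<Longrightarrow> expectation (Z i) = 0"
    and var: "\<And>i. i \<in> {s<..s + n} \<Longrightarrow> expectation (\<lambda>\<omega>. (Z i \<omega>)^2) \<le> v"
    and m4: "\<And>i. i \<in> {s<..s + n} \<Longrightarrow> expectation (\<lambda>\<omega>. (Z i \<omega>)^4) \<le> q"
    and v: "v \<ge> 0"
  shows "expectation (\<lambda>\<omega>. (\<Sum>i\<in>{s<..s + n}. Z i \<omega>) ^ 4) \<le> real n * q + 3 * (real n)\<^sup>2 * v\<^sup>2"
proof -
  have Zm[measurable]: "Z i \<in> borel_measurable M" if "i \<in> {s<..s + n}" for i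
    using ind that by (auto simp: indep_vars_def2)
  have Sm: "(\<lambda>\<omega>. \<Sum>j\<in>{s<..s + i}. Z j \<omega>) \<in> borel_measurable M" if "i \<le> n" for i
    using that by (intro borel_measurable_sum) auto
  have Sb: "\<bar>\<Sum>j\<in>{s<..s + i}. Z j \<omega>\<bar> \<le> i * K" if "i \<le> n" for i \<omega>
  proof -
    have "\<bar>\<Sum>j\<in>{s<..s + i}. Z j \<omega>\<bar> \<le> (\<Sum>j\<in>{s<..s + i}. \<bar>Z j \<omega>\<bar>)" by (rule sum_abs)
    also have "\<dots> \<le> (\<Sum>j\<in>{s<..s + i}. K)" using that by (intro sum_mono bd) auto
    finally show ?thesis by simp
  qed
  have pint: "integrable M (\<lambda>\<omega>. (f \<omega>) ^ p)" if "f \<in> borel_measurable M" "\<And>\<omega>. \<bar>f \<omega>\<bar> \<le> C" for f :: "'a \<Rightarrow> real" and p C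
    using that
    by (intro integrable_const_bound[where B = "C ^ p"]) (auto simp: power_abs intro!: power_mono)
  have "expectation (\<lambda>\<omega>. (\<Sum>j\<in>{s<..s + i}. Z j \<omega>)^2) \<le> i * v \<and>
      expectation (\<lambda>\<omega>. (\<Sum>j\<in>{s<..s + i}. Z j \<omega>)^4) \<le> real i * q + 3 * (real i)\<^sup>2 * v\<^sup>2" if "i \<le> n" for i
    using that
  proof (induction i)
    case 0 then show ?case by simp
  next
    case (Suc i)
    define S where "S \<omega> = (\<Sum>j\<in>{s<..s + i}. Z j \<omega>)" for \<omega>
    define W where "W = Z (s + Suc i)"
    have sumS: "(\<Sum>j\<in>{s<..s + Suc i}. Z j \<omega>) = S \<omega> + W \<omega>" for \<omega>
    proof -
      have "{s<..s + Suc i} = insert (s + Suc i) {s<..s + i}" by auto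
      then show ?thesis by (simp add: S_def W_def)
    qed
    have Sint: "integrable M (\<lambda>\<omega>. S \<omega> ^ p)" for p
      unfolding S_def using Sm[of i] Sb[of i] Suc.prems by (intro pint) auto
    have Wint: "integrable M (\<lambda>\<omega>. W \<omega> ^ p)" for p
      unfolding W_def using bd[of "s + Suc i"] Zm[of "s + Suc i"] Suc.prems by (intro pint) auto
    have sub: "indep_vars (\<lambda>_. borel) Z ({s<..s + i} \<union> {s + Suc i})"
      by (rule indep_vars_subset[OF ind]) (use Suc.prems in auto)
    have iv: "indep_var borel (\<lambda>\<omega>. S \<omega> ^ p) borel (\<lambda>\<omega>. W \<omega> ^ r)" for p r
    proof -
      have "indep_var borel (\<lambda>\<omega>. (\<lambda>f. (\<Sum>j\<in>{s<..s + i}. f j) ^ p) (restrict (\<lambda>i. Z i \<omega>) {s<..s + i})) borel (\<lambda>\<omega>. Z (s + Suc i) \<omega> ^ r)"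
        by (rule indep_var_of_block[OF sub, where w = "\<lambda>z. z ^ r"])
          (auto intro!: borel_measurable_power borel_measurable_sum measurable_component_singleton)
      then show ?thesis by (simp add: S_def W_def)
    qed
    have PI: "integrable M (\<lambda>\<omega>. S \<omega> ^ p * W \<omega> ^ r)"
      and PE: "expectation (\<lambda>\<omega>. S \<omega> ^ p * W \<omega> ^ r) = expectation (\<lambda>\<omega>. S \<omega> ^ p) * expectation (\<lambda>\<omega>. W \<omega> ^ r)" for p r
      by (rule indep_var_integrable[OF iv Sint Wint], rule indep_var_lebesgue_integral[OF iv Sint Wint])
    have W1: "expectation (\<lambda>\<omega>. W \<omega> ^ 1) = 0" using mean[of "s + Suc i"] Suc.prems by (simp add: W_def)
    have W2: "expectation (\<lambda>\<omega>. W \<omega> ^ 2) \<le> v" using var[of "s + Suc i"] Suc.prems by (simp add: W_def)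
    have W4: "expectation (\<lambda>\<omega>. W \<omega> ^ 4) \<le> q" using m4[of "s + Suc i"] Suc.prems by (simp add: W_def)
    have IH: "expectation (\<lambda>\<omega>. S \<omega> ^ 2) \<le> i * v" "expectation (\<lambda>\<omega>. S \<omega> ^ 4) \<le> real i * q + 3 * (real i)\<^sup>2 * v\<^sup>2"
      using Suc by (auto simp: S_def)
    have e2: "(S \<omega> + W \<omega>)^2 = S \<omega> ^ 2 + 2 * (S \<omega> ^ 1 * W \<omega> ^ 1) + W \<omega> ^ 2" for \<omega>
      by (simp add: power2_eq_square algebra_simps)
    have e4: "(S \<omega> + W \<omega>)^4 = S \<omega> ^ 4 + 4 * (S \<omega> ^ 3 * W \<omega> ^ 1) + 6 * (S \<omega> ^ 2 * W \<omega> ^ 2) + 4 * (S \<omega> ^ 1 * W \<omega> ^ 3) + W \<omega> ^ 4" for \<omega>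
      by (simp add: power2_eq_square power3_eq_cube power4_eq_xxxx algebra_simps)
    have E2: "expectation (\<lambda>\<omega>. (S \<omega> + W \<omega>)^2) = expectation (\<lambda>\<omega>. S \<omega> ^ 2) + expectation (\<lambda>\<omega>. W \<omega> ^ 2)"
      unfolding e2 using Sint Wint PI[of 1 1] PE[of 1 1] W1 by (simp del: power_one_right)
    have E4: "expectation (\<lambda>\<omega>. (S \<omega> + W \<omega>)^4) =
        expectation (\<lambda>\<omega>. S \<omega> ^ 4) + 6 * (expectation (\<lambda>\<omega>. S \<omega> ^ 2) * expectation (\<lambda>\<omega>. W \<omega> ^ 2)) + expectation (\<lambda>\<omega>. W \<omega> ^ 4)
        + 4 * (expectation (\<lambda>\<omega>. S \<omega> ^ 1) * expectation (\<lambda>\<omega>. W \<omega> ^ 3))"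
      unfolding e4 using Sint[of 4] Wint[of 4] PI[of 3 1] PI[of 2 2] PI[of 1 3] PE[of 3 1] PE[of 2 2] PE[of 1 3] W1
      by (simp del: power_one_right)
    have S1: "expectation (\<lambda>\<omega>. S \<omega> ^ 1) = 0"
    proof -
      have "expectation (\<lambda>\<omega>. \<Sum>j\<in>{s<..s + i}. Z j \<omega>) = (\<Sum>j\<in>{s<..s + i}. expectation (Z j))"
      proof (rule Bochner_Integration.integral_sum)
        fix j assume j: "j \<in> {s<..s + i}"
        then have "j \<in> {s<..s + n}" using Suc.prems by auto
        then show "integrable M (Z j)" using pint[of "Z j" K 1] bd[of j] Zm[of j] by simp
      qed
      also have "\<dots> = 0" using Suc.prems by (intro sum.neutral) (auto intro!: mean)
      finally show ?thesis by (simp add: S_def)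
    qed
    have prod: "expectation (\<lambda>\<omega>. S \<omega> ^ 2) * expectation (\<lambda>\<omega>. W \<omega> ^ 2) \<le> (i * v) * v"
      using IH W2 v by (intro mult_mono) (auto intro!: Bochner_Integration.integral_nonneg)
    have "expectation (\<lambda>\<omega>. (S \<omega> + W \<omega>)^4) \<le> real i * q + 3 * (real i)\<^sup>2 * v\<^sup>2 + 6 * (i * v * v) + q"
      unfolding E4 S1 using prod IH W4 by simp
    also have "\<dots> \<le> real (Suc i) * q + 3 * (real (Suc i))\<^sup>2 * v\<^sup>2"
    proof -
      have "3 * (real (Suc i))^2 * v^2 = 3 * (real i)\<^sup>2 * v\<^sup>2 + 6 * (i * v * v) + 3 * v^2"
        by (simp add: power2_eq_square algebra_simps)
      then show ?thesis by (simp add: algebra_simps)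
    qed
    finally have "expectation (\<lambda>\<omega>. (S \<omega> + W \<omega>)^4) \<le> real (Suc i) * q + 3 * (real (Suc i))\<^sup>2 * v\<^sup>2" .
    moreover have "expectation (\<lambda>\<omega>. (S \<omega> + W \<omega>)^2) \<le> Suc i * v"
      unfolding E2 using IH W2 by (simp add: algebra_simps)
    ultimately show ?case unfolding sumS by simp
  qed
  from this[of n] show ?thesis by simp
qed

text \<open>
  The second Borel-Cantelli lemma: by independence the probability that none of the events from
  index $n$ on occurs is at most $\prod (1 - p_k) \le \exp (-\sum p_k) = 0$.
\<close>

lemma (in prob_space) borel_cantelli_indep:
  fixes Y :: "nat \<Rightarrow> 'a \<Rightarrow> real"
  assumes ind: "indep_vars (\<lambda>_. borel) Y UNIV"
    and ns: "\<not> summable (\<lambda>k. prob {\<omega> \<in> space M. z k \<le> Y k \<omega>})"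
  shows "AE \<omega> in M. \<exists>\<^sub>F k in sequentially. z k \<le> Y k \<omega>"
proof -
  have [measurable]: "Y k \<in> borel_measurable M" for k using ind by (auto simp: indep_vars_def2)
  define p where "p k = prob {\<omega> \<in> space M. z k \<le> Y k \<omega>}" for k
  have null: "prob (\<Inter>k\<in>{n..}. {\<omega> \<in> space M. Y k \<omega> < z k}) = 0" for n
  proof -
    have le: "prob (\<Inter>k\<in>{n..}. {\<omega> \<in> space M. Y k \<omega> < z k}) \<le> exp (- (\<Sum>k\<in>{n..n+m}. p k))" for m
    proof -
      have "prob (\<Inter>k\<in>{n..}. {\<omega> \<in> space M. Y k \<omega> < z k}) \<le> prob (\<Inter>k\<in>{n..n+m}. Y k -` {..<z k} \<inter> space M)"
        by (intro finite_measure_mono sets.finite_INT) auto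
      also have "\<dots> = (\<Prod>k\<in>{n..n+m}. prob (Y k -` {..<z k} \<inter> space M))"
        by (intro indep_varsD[OF ind]) auto
      also have "\<dots> \<le> (\<Prod>k\<in>{n..n+m}. exp (- p k))"
      proof (intro prod_mono conjI measure_nonneg)
        fix k
        have "prob (Y k -` {..<z k} \<inter> space M) = prob (space M - {\<omega> \<in> space M. z k \<le> Y k \<omega>})"
          by (rule arg_cong[where f = prob]) auto
        also have "\<dots> = 1 - p k" unfolding p_def by (intro prob_compl) measurable
        also have "\<dots> \<le> exp (- p k)" using exp_ge_add_one_self[of "- p k"] by simp
        finally show "prob (Y k -` {..<z k} \<inter> space M) \<le> exp (- p k)" .
      qed
      also have "\<dots> = exp (- (\<Sum>k\<in>{n..n+m}. p k))" by (simp add: exp_sum[symmetric] sum_negf)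
      finally show ?thesis .
    qed
    show ?thesis
    proof (rule ccontr)
      define q where "q = prob (\<Inter>k\<in>{n..}. {\<omega> \<in> space M. Y k \<omega> < z k})"
      assume "prob (\<Inter>k\<in>{n..}. {\<omega> \<in> space M. Y k \<omega> < z k}) \<noteq> 0"
      then have q: "q > 0" by (simp add: q_def zero_less_measure_iff)
      have "(\<Sum>k\<in>{n..n+m}. p k) \<le> - ln q" for m
        using le[of m] q unfolding q_def[symmetric] by (subst (asm) ln_le_cancel_iff[symmetric]) auto
      then have b: "(\<Sum>k<m. p (k + n)) \<le> - ln q" for m
      proof (cases m)
        case 0
        have "q \<le> 1" by (simp add: q_def)
        then show ?thesis using 0 q by simp
      next
        case (Suc m')
        have "(\<Sum>k<m. p (k + n)) = (\<Sum>k\<in>{n..n+m'}. p k)"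
          unfolding Suc lessThan_Suc_atMost
          by (rule sum.reindex_bij_witness[where i = "\<lambda>k. k - n" and j = "\<lambda>k. k + n"]) auto
        then show ?thesis using \<open>\<And>m. (\<Sum>k\<in>{n..n+m}. p k) \<le> - ln q\<close> by simp
      qed
      have "summable (\<lambda>k. p (k + n))"
        by (rule summableI_nonneg_bounded[OF _ b]) (simp add: p_def)
      then show False using ns by (simp add: p_def[symmetric] summable_iff_shift)
    qed
  qed
  have "AE \<omega> in M. \<forall>n. \<omega> \<notin> (\<Inter>k\<in>{n..}. {\<omega> \<in> space M. Y k \<omega> < z k})"
  proof (subst AE_all_countable, intro allI)
    fix n
    have m: "(\<Inter>k\<in>{n..}. {\<omega> \<in> space M. Y k \<omega> < z k}) \<in> sets M"
      by (intro sets.countable_INT') auto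
    show "AE \<omega> in M. \<omega> \<notin> (\<Inter>k\<in>{n..}. {\<omega> \<in> space M. Y k \<omega> < z k})"
      using null[of n] m by (intro AE_not_in) (auto simp: null_sets_def emeasure_eq_measure)
  qed
  moreover have "AE \<omega> in M. \<omega> \<in> space M" by simp
  ultimately show ?thesis
  proof eventually_elim
    case (elim \<omega>)
    then show ?case by (auto simp: frequently_def eventually_sequentially not_le) 
  qed
qed

section \<open>Truncation of an i.i.d. sequence\<close>

definition trunc :: "real \<Rightarrow> real \<Rightarrow> real" where
  "trunc b x = (if \<bar>x\<bar> \<le> b then x else 0)"

definition mid :: "real \<Rightarrow> real \<Rightarrow> real \<Rightarrow> real" where
  "mid b c x = (if b < \<bar>x\<bar> \<and> \<bar>x\<bar> \<le> c then \<bar>x\<bar> else 0)"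

lemma trunc_measurable[measurable]: "trunc b \<in> borel_measurable borel"
  unfolding trunc_def[abs_def] by measurable

lemma mid_measurable[measurable]: "mid b c \<in> borel_measurable borel"
  unfolding mid_def[abs_def] by measurable

text \<open>
  The middle part is taken with absolute values, so that its window sums are monotone in the window
  and need no maximal inequality.
\<close>

lemma le_trunc_plus_mid: "\<bar>x\<bar> \<le> c \<Longrightarrow> x \<le> trunc b x + mid b c x"
  by (auto simp: trunc_def mid_def)

text \<open>
  The variables are indexed from 1.  Everything that concerns a single variable is computed under
  their common distribution \<open>\<mu>\<close>.
\<close>

locale iid_seq = prob_space M for M :: "'a measure" +
  fixes X :: "nat \<Rightarrow> 'a \<Rightarrow> real" and \<mu> :: "real measure" and \<sigma> :: real
  assumes indep_X: "indep_vars (\<lambda>_. borel) X {1..}"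
    and distr_X: "\<And>j. j \<ge> 1 \<Longrightarrow> distr M borel (X j) = \<mu>"
    and sq_int: "integrable \<mu> (\<lambda>x. x\<^sup>2)"
    and mean0: "(LINT x|\<mu>. x) = 0"
    and var: "(LINT x|\<mu>. x\<^sup>2) = \<sigma>\<^sup>2"
    and \<sigma>_pos: "\<sigma> > 0"
begin

lemma X_meas: "j \<ge> 1 \<Longrightarrow> X j \<in> borel_measurable M"
  using indep_X by (auto simp: indep_vars_def2)

lemma sets_\<mu>[measurable_cong]: "sets \<mu> = sets borel"
  using distr_X[of 1] by (metis order_refl sets_distr)

sublocale \<mu>: prob_space \<mu>
  using prob_space_distr[OF X_meas[of 1]] distr_X[of 1] by simp

lemma expectation_X:
  fixes f :: "real \<Rightarrow> real"
  assumes "j \<ge> 1" "f \<in> borel_measurable borel"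
  shows "expectation (\<lambda>\<omega>. f (X j \<omega>)) = (LINT x|\<mu>. f x)"
  using integral_distr[OF X_meas assms(2), OF assms(1)] distr_X[OF assms(1)] by simp

lemma integrable_X:
  fixes f :: "real \<Rightarrow> real"
  assumes "j \<ge> 1" "f \<in> borel_measurable borel" "integrable \<mu> f"
  shows "integrable M (\<lambda>\<omega>. f (X j \<omega>))"
  using integrable_distr_eq[OF X_meas assms(2), OF assms(1)] distr_X[OF assms(1)] assms(3) by simp

lemma prob_X:
  assumes "j \<ge> 1" "A \<in> sets borel"
  shows "prob {\<omega> \<in> space M. X j \<omega> \<in> A} = measure \<mu> A"
proof -
  have "measure \<mu> A = measure (distr M borel (X j)) A" using distr_X assms by simp
  also have "\<dots> = prob (X j -` A \<inter> space M)" using assms X_meas by (intro measure_distr) auto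
  also have "X j -` A \<inter> space M = {\<omega> \<in> space M. X j \<omega> \<in> A}" by auto
  finally show ?thesis by simp
qed

lemma indep_image:
  assumes "f \<in> borel_measurable borel"
  shows "indep_vars (\<lambda>_. borel) (\<lambda>i \<omega>. f (X i \<omega>) :: real) {s<..s + n}"
  by (rule indep_vars_compose2[OF indep_vars_subset[OF indep_X], where Y = "\<lambda>_. f"]) (use assms in auto)

lemma block_sum_meas:
  assumes "f \<in> borel_measurable borel"
  shows "(\<lambda>\<omega>. \<Sum>j\<in>{s<..n}. f (X j \<omega>) :: real) \<in> borel_measurable M"
proof (rule borel_measurable_sum)
  fix i assume "i \<in> {s<..n}"
  then have [measurable]: "X i \<in> borel_measurable M" by (intro X_meas) auto
  show "(\<lambda>\<omega>. f (X i \<omega>)) \<in> borel_measurable M" using assms by measurable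
qed

lemma exceed_meas:
  assumes [measurable]: "f \<in> borel_measurable borel"
  shows "{\<omega> \<in> space M. \<exists>i\<le>n. z \<le> (\<Sum>j\<in>{s<..s + i}. f (X j \<omega>) :: real)} \<in> sets M"
proof -
  have "{\<omega> \<in> space M. \<exists>i\<le>n. z \<le> (\<Sum>j\<in>{s<..s + i}. f (X j \<omega>))} = (\<Union>i\<in>{..n}. {\<omega> \<in> space M. z \<le> (\<Sum>j\<in>{s<..s + i}. f (X j \<omega>))})"
    by auto
  also have "\<dots> \<in> sets M"
  proof (intro sets.finite_UN)
    fix i
    have [measurable]: "(\<lambda>\<omega>. \<Sum>j\<in>{s<..s + i}. f (X j \<omega>)) \<in> borel_measurable M" by (rule block_sum_meas) fact
    show "{\<omega> \<in> space M. z \<le> (\<Sum>j\<in>{s<..s + i}. f (X j \<omega>))} \<in> sets M" by measurable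
  qed auto
  finally show ?thesis .
qed

lemma integrable_dominated:
  fixes f g :: "real \<Rightarrow> real"
  assumes "integrable \<mu> g" "f \<in> borel_measurable borel" "\<And>x. \<bar>f x\<bar> \<le> g x"
  shows "integrable \<mu> f"
proof (rule Bochner_Integration.integrable_bound[OF assms(1)])
  show "f \<in> borel_measurable \<mu>" using assms(2) by measurable
  show "AE x in \<mu>. norm (f x) \<le> norm (g x)" using assms(3) by (intro AE_I2) (smt (verit) real_norm_def)
qed

lemma id_int: "integrable \<mu> (\<lambda>x. x)"
  by (rule \<mu>.square_integrable_imp_integrable[OF _ sq_int]) measurable

text \<open>
  The part of the variance carried by values beyond $b$; it controls the means of both truncated
  parts.
\<close>

definition \<rho> :: "real \<Rightarrow> real" where
  "\<rho> b = (LINT x|\<mu>. (if b < \<bar>x\<bar> then x\<^sup>2 else 0))"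

text \<open>
  A truncated third moment, normalised by the truncation level.  For one level it can be of the
  order of the variance, but along a geometric sequence of levels it is summable.
\<close>

definition w :: "real \<Rightarrow> real" where
  "w c = (LINT x|\<mu>. (if \<bar>x\<bar> \<le> c then \<bar>x\<bar> ^ 3 else 0)) / c"

lemma \<rho>_int: "integrable \<mu> (\<lambda>x. if b < \<bar>x\<bar> then x\<^sup>2 else 0)"
  by (rule integrable_dominated[OF sq_int]) auto

lemma \<rho>_nonneg: "\<rho> b \<ge> 0"
  unfolding \<rho>_def by (intro Bochner_Integration.integral_nonneg) auto

lemma \<rho>_tendsto_0: "(\<rho> \<longlongrightarrow> 0) at_top"
proof -
  have "((\<lambda>b. LINT x|\<mu>. (if b < \<bar>x\<bar> then x\<^sup>2 else 0)) \<longlongrightarrow> (LINT x|\<mu>. 0)) at_top"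
  proof (rule integral_dominated_convergence_at_top[where w = "\<lambda>x. x\<^sup>2"])
    show "AE x in \<mu>. ((\<lambda>b. if b < \<bar>x\<bar> then x\<^sup>2 else 0) \<longlongrightarrow> 0) at_top"
    proof (rule AE_I2)
      fix x :: real
      have "eventually (\<lambda>b. (if b < \<bar>x\<bar> then x\<^sup>2 else 0) = 0) at_top"
        using eventually_ge_at_top[of "\<bar>x\<bar>"] by eventually_elim auto
      then show "((\<lambda>b. if b < \<bar>x\<bar> then x\<^sup>2 else 0) \<longlongrightarrow> 0) at_top"
        by (rule tendsto_eventually)
    qed
  qed (use sq_int in auto)
  then show ?thesis by (simp add: \<rho>_def[abs_def])
qed

lemma trunc_int: "b > 0 \<Longrightarrow> integrable \<mu> (trunc b)"
  by (rule integrable_dominated[of "\<lambda>_. b"]) (auto simp: trunc_def)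

lemma abs_mean_trunc:
  assumes "b > 0"
  shows "\<bar>LINT x|\<mu>. trunc b x\<bar> \<le> \<rho> b / b"
proof -
  have i: "integrable \<mu> (\<lambda>x. x - trunc b x)" using id_int trunc_int[OF assms] by simp
  have "(LINT x|\<mu>. x - trunc b x) = - (LINT x|\<mu>. trunc b x)"
    by (subst Bochner_Integration.integral_diff[OF id_int trunc_int[OF assms]]) (simp add: mean0)
  then have "\<bar>LINT x|\<mu>. trunc b x\<bar> = \<bar>LINT x|\<mu>. x - trunc b x\<bar>" by simp
  also have "\<dots> \<le> (LINT x|\<mu>. \<bar>x - trunc b x\<bar>)" by (rule integral_abs_bound)
  also have "\<dots> \<le> (LINT x|\<mu>. (if b < \<bar>x\<bar> then x\<^sup>2 else 0) / b)"
  proof (rule integral_mono)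
    show "integrable \<mu> (\<lambda>x. \<bar>x - trunc b x\<bar>)" using i by simp
    show "integrable \<mu> (\<lambda>x. (if b < \<bar>x\<bar> then x\<^sup>2 else 0) / b)" using \<rho>_int[of b] by simp
    fix x :: real
    have "\<bar>x\<bar> * b \<le> x\<^sup>2" if "b < \<bar>x\<bar>"
    proof -
      have "\<bar>x\<bar> * b \<le> \<bar>x\<bar> * \<bar>x\<bar>" using that by (intro mult_left_mono) auto
      then show ?thesis by (simp add: power2_eq_square abs_mult[symmetric])
    qed
    then show "\<bar>x - trunc b x\<bar> \<le> (if b < \<bar>x\<bar> then x\<^sup>2 else 0) / b"
      using assms by (auto simp: trunc_def field_simps)
  qed
  also have "\<dots> = \<rho> b / b" by (simp add: \<rho>_def)
  finally show ?thesis .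
qed

lemma exp_trunc_int: "b > 0 \<Longrightarrow> integrable \<mu> (\<lambda>x. exp (t * trunc b x))"
  by (rule integrable_dominated[of "\<lambda>_. exp (\<bar>t\<bar> * b)"])
    (auto simp: trunc_def intro!: order.trans[OF abs_ge_self[of "t * _"]] mult_left_mono simp: abs_mult)

text \<open>
  Second-order expansion of the exponential.  Truncation shifts the mean by at most
  $\rho(b)/b$, since $|x| \le x^2/b$ beyond $b$.
\<close>

lemma mgf_trunc:
  assumes "b > 0"
  shows "(LINT x|\<mu>. exp (t * trunc b x)) \<le> exp (\<bar>t\<bar> * \<rho> b / b + t\<^sup>2 * \<sigma>\<^sup>2 * exp (\<bar>t\<bar> * b) / 2)"
proof -
  define E where "E = exp (\<bar>t\<bar> * b)"
  have "(LINT x|\<mu>. exp (t * trunc b x)) \<le> (LINT x|\<mu>. 1 + t * trunc b x + t\<^sup>2 * E / 2 * x\<^sup>2)"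
  proof (rule integral_mono)
    show "integrable \<mu> (\<lambda>x. exp (t * trunc b x))" by (rule exp_trunc_int[OF assms])
    show "integrable \<mu> (\<lambda>x. 1 + t * trunc b x + t\<^sup>2 * E / 2 * x\<^sup>2)"
      using trunc_int[OF assms] sq_int by simp
    fix x
    have "exp (t * trunc b x) \<le> 1 + t * trunc b x + (t * trunc b x)\<^sup>2 / 2 * exp \<bar>t * trunc b x\<bar>"
      by (rule exp_le_quadratic)
    also have "(t * trunc b x)\<^sup>2 / 2 * exp \<bar>t * trunc b x\<bar> \<le> (t\<^sup>2 * x\<^sup>2) / 2 * E"
    proof (rule mult_mono)
      show "(t * trunc b x)\<^sup>2 / 2 \<le> (t\<^sup>2 * x\<^sup>2) / 2" by (auto simp: trunc_def power_mult_distrib)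
      show "exp \<bar>t * trunc b x\<bar> \<le> E"
        using assms by (auto simp: E_def trunc_def abs_mult intro!: mult_left_mono)
    qed auto
    finally show "exp (t * trunc b x) \<le> 1 + t * trunc b x + t\<^sup>2 * E / 2 * x\<^sup>2" by (simp add: algebra_simps)
  qed
  also have "\<dots> = 1 + t * (LINT x|\<mu>. trunc b x) + t\<^sup>2 * E / 2 * \<sigma>\<^sup>2"
    using trunc_int[OF assms] sq_int by (simp add: var \<mu>.prob_space)
  also have "t * (LINT x|\<mu>. trunc b x) \<le> \<bar>t\<bar> * (\<rho> b / b)"
  proof -
    have "t * (LINT x|\<mu>. trunc b x) \<le> \<bar>t\<bar> * \<bar>LINT x|\<mu>. trunc b x\<bar>"
      by (metis abs_ge_self abs_mult)
    also have "\<dots> \<le> \<bar>t\<bar> * (\<rho> b / b)" by (intro mult_left_mono abs_mean_trunc assms) auto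
    finally show ?thesis .
  qed
  also have "1 + \<bar>t\<bar> * (\<rho> b / b) + t\<^sup>2 * E / 2 * \<sigma>\<^sup>2 \<le> exp (\<bar>t\<bar> * (\<rho> b / b) + t\<^sup>2 * E / 2 * \<sigma>\<^sup>2)"
    using exp_ge_add_one_self[of "\<bar>t\<bar> * (\<rho> b / b) + t\<^sup>2 * E / 2 * \<sigma>\<^sup>2"] by (simp add: add.assoc)
  finally show ?thesis by (simp add: E_def mult_ac)
qed

lemma trunc_maximal_inequality:
  fixes n s :: nat
  assumes b: "b > 0" and t: "t \<ge> 0" and c: "\<bar>c\<bar> = (1::real)"
  shows "prob {\<omega> \<in> space M. \<exists>i\<le>n. x \<le> (\<Sum>j\<in>{s<..s + i}. c * trunc b (X j \<omega>))}
    \<le> exp (- t * x + n * (t * \<rho> b / b + t\<^sup>2 * \<sigma>\<^sup>2 * exp (t * b) / 2))"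
proof -
  define \<phi> where "\<phi> = exp (t * \<rho> b / b + t\<^sup>2 * \<sigma>\<^sup>2 * exp (t * b) / 2)"
  have "prob {\<omega> \<in> space M. \<exists>i\<le>n. x \<le> (\<Sum>j\<in>{s<..s + i}. c * trunc b (X j \<omega>))} \<le> exp (- t * x) * \<phi> ^ n"
  proof (rule maximal_exponential_inequality[OF indep_image _ _ _ t])
    fix i assume i: "i \<in> {s<..s + n}"
    have e: "exp (t * (c * trunc b y)) = exp ((t * c) * trunc b y)" for y by (simp add: mult_ac)
    show "integrable M (\<lambda>\<omega>. exp (t * (c * trunc b (X i \<omega>))))"
      unfolding e using i by (intro integrable_X[where f = "\<lambda>y. exp ((t * c) * trunc b y)"] exp_trunc_int b) auto
    have "expectation (\<lambda>\<omega>. exp (t * (c * trunc b (X i \<omega>)))) = (LINT y|\<mu>. exp ((t * c) * trunc b y))"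
      unfolding e using i by (intro expectation_X[where f = "\<lambda>y. exp ((t * c) * trunc b y)"]) auto
    also have "\<dots> \<le> exp (\<bar>t * c\<bar> * \<rho> b / b + (t * c)\<^sup>2 * \<sigma>\<^sup>2 * exp (\<bar>t * c\<bar> * b) / 2)"
      by (rule mgf_trunc[OF b])
    also have "\<dots> = \<phi>"
    proof -
      have "(t * c)\<^sup>2 = \<bar>t * c\<bar>\<^sup>2" by simp
      also have "\<bar>t * c\<bar> = t" using c t by (simp add: abs_mult)
      finally show ?thesis using \<open>\<bar>t * c\<bar> = t\<close> by (simp add: \<phi>_def)
    qed
    finally show "expectation (\<lambda>\<omega>. exp (t * (c * trunc b (X i \<omega>)))) \<le> \<phi>" .
  next
    show "\<phi> \<ge> 1" using t b \<rho>_nonneg[of b] by (auto simp: \<phi>_def)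
  qed auto
  also have "\<dots> = exp (- t * x + n * (t * \<rho> b / b + t\<^sup>2 * \<sigma>\<^sup>2 * exp (t * b) / 2))"
    by (simp only: \<phi>_def exp_of_nat_mult[symmetric] exp_add[symmetric])
  finally show ?thesis .
qed

lemma w_int: "integrable \<mu> (\<lambda>x. if \<bar>x\<bar> \<le> c then \<bar>x\<bar> ^ 3 else 0)"
  by (rule integrable_dominated[of "\<lambda>_. \<bar>c\<bar> ^ 3"]) (auto intro!: power_mono)

lemma w_nonneg: "c \<ge> 0 \<Longrightarrow> w c \<ge> 0"
  unfolding w_def by (intro divide_nonneg_nonneg Bochner_Integration.integral_nonneg) auto

text \<open>
  Interchanging sum and expectation, a fixed $x$ contributes $|x|^3$ times the sum of
  $2^{-k/2}$ over the levels $2^{k/2} \ge |x|$, which is of order $x^2$.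
\<close>

lemma summable_w: "summable (\<lambda>k. w (sqrt (2 ^ k)))"
proof (rule summableI_nonneg_bounded)
  define r :: real where "r = sqrt 2"
  have r: "r > 1" by (simp add: r_def)
  define C where "C = r / (r - 1)"
  have sr: "sqrt (2 ^ k) = r ^ k" for k by (simp add: r_def real_sqrt_power)
  show "w (sqrt (2 ^ k)) \<ge> 0" for k by (rule w_nonneg) simp
  fix K
  have "(\<Sum>k<K. w (sqrt (2 ^ k))) = (LINT x|\<mu>. (\<Sum>k<K. (if \<bar>x\<bar> \<le> r ^ k then \<bar>x\<bar> ^ 3 else 0) / r ^ k))"
    unfolding w_def sr by (subst Bochner_Integration.integral_sum) (use w_int in auto)
  also have "\<dots> \<le> (LINT x|\<mu>. C * x\<^sup>2)"
  proof (rule integral_mono)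
    show "integrable \<mu> (\<lambda>x. \<Sum>k<K. (if \<bar>x\<bar> \<le> r ^ k then \<bar>x\<bar> ^ 3 else 0) / r ^ k)"
      using w_int by (intro Bochner_Integration.integrable_sum integrable_divide)
    show "integrable \<mu> (\<lambda>x. C * x\<^sup>2)" using sq_int by simp
    fix x :: real
    show "(\<Sum>k<K. (if \<bar>x\<bar> \<le> r ^ k then \<bar>x\<bar> ^ 3 else 0) / r ^ k) \<le> C * x\<^sup>2"
    proof (cases "x = 0")
      case False
      have "(\<Sum>k<K. (if \<bar>x\<bar> \<le> r ^ k then \<bar>x\<bar> ^ 3 else 0) / r ^ k) = \<bar>x\<bar> ^ 3 * (\<Sum>k<K. if \<bar>x\<bar> \<le> r ^ k then 1 / r ^ k else 0)"
        by (subst sum_distrib_left) (auto intro!: sum.cong)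
      also have "\<dots> \<le> \<bar>x\<bar> ^ 3 * (C / \<bar>x\<bar>)"
        unfolding C_def using False r by (intro mult_left_mono truncated_geometric_sum) auto
      also have "\<dots> = C * x\<^sup>2" using False by (simp add: power2_eq_square power3_eq_cube abs_mult[symmetric])
      finally show ?thesis .
    next
      case True
      then have "(\<Sum>k<K. (if \<bar>x\<bar> \<le> r ^ k then \<bar>x\<bar> ^ 3 else 0) / r ^ k) = 0" by (intro sum.neutral) auto
      with True show ?thesis by simp
    qed
  qed
  also have "\<dots> = C * \<sigma>\<^sup>2" by (simp add: var)
  finally show "(\<Sum>k<K. w (sqrt (2 ^ k))) \<le> C * \<sigma>\<^sup>2" .
qed

lemma mid_power_int: "integrable \<mu> (\<lambda>x. mid b c x ^ p)"
proof (rule integrable_dominated[of "\<lambda>_. \<bar>c\<bar> ^ p"])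
  show "\<bar>mid b c x ^ p\<bar> \<le> \<bar>c\<bar> ^ p" for x
    unfolding power_abs by (rule power_mono) (auto simp: mid_def)
qed auto

text \<open>
  Beyond $b$ one may multiply by $|x|/b$, and below $c$ divide by $|x|/c$, to reach the moment
  that is available.
\<close>

lemma mid_moments:
  assumes b: "b > 0" and c: "c > 0"
  shows "(LINT x|\<mu>. mid b c x) \<le> \<rho> b / b"
    and "(LINT x|\<mu>. (mid b c x)\<^sup>2) \<le> \<sigma>\<^sup>2"
    and "(LINT x|\<mu>. (mid b c x)\<^sup>2) \<le> w c * c / b"
    and "(LINT x|\<mu>. (mid b c x) ^ 4) \<le> c\<^sup>2 * w c"
proof -
  note i = mid_power_int[of b c]
  have "(LINT x|\<mu>. mid b c x) \<le> (LINT x|\<mu>. (if b < \<bar>x\<bar> then x\<^sup>2 else 0) / b)"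
  proof (rule integral_mono)
    show "integrable \<mu> (mid b c)" using i[of 1] by simp
    show "integrable \<mu> (\<lambda>x. (if b < \<bar>x\<bar> then x\<^sup>2 else 0) / b)" using \<rho>_int[of b] by simp
    fix x :: real
    have "\<bar>x\<bar> * b \<le> x\<^sup>2" if "b < \<bar>x\<bar>"
    proof -
      have "\<bar>x\<bar> * b \<le> \<bar>x\<bar> * \<bar>x\<bar>" using that by (intro mult_left_mono) auto
      then show ?thesis by (simp add: power2_eq_square abs_mult[symmetric])
    qed
    then show "mid b c x \<le> (if b < \<bar>x\<bar> then x\<^sup>2 else 0) / b"
      using assms by (auto simp: mid_def field_simps)
  qed
  then show "(LINT x|\<mu>. mid b c x) \<le> \<rho> b / b" by (simp add: \<rho>_def)
  have "(LINT x|\<mu>. (mid b c x)\<^sup>2) \<le> (LINT x|\<mu>. x\<^sup>2)"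
    using i[of 2] sq_int by (intro integral_mono) (auto simp: mid_def)
  then show "(LINT x|\<mu>. (mid b c x)\<^sup>2) \<le> \<sigma>\<^sup>2" by (simp add: var)
  have "(LINT x|\<mu>. (mid b c x)\<^sup>2) \<le> (LINT x|\<mu>. (if \<bar>x\<bar> \<le> c then \<bar>x\<bar> ^ 3 else 0) / b)"
  proof (rule integral_mono)
    fix x :: real
    have "\<bar>x\<bar>\<^sup>2 * b \<le> \<bar>x\<bar>\<^sup>2 * \<bar>x\<bar>" if "b < \<bar>x\<bar>" using that by (intro mult_left_mono) auto
    then have "\<bar>x\<bar>\<^sup>2 \<le> \<bar>x\<bar> ^ 3 / b" if "b < \<bar>x\<bar>"
      using b that by (simp add: pos_le_divide_eq power3_eq_cube power2_eq_square mult.assoc)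
    then show "(mid b c x)\<^sup>2 \<le> (if \<bar>x\<bar> \<le> c then \<bar>x\<bar> ^ 3 else 0) / b"
      using b by (auto simp: mid_def simp del: power2_abs)
  qed (use i[of 2] w_int in auto)
  then show "(LINT x|\<mu>. (mid b c x)\<^sup>2) \<le> w c * c / b" using c by (simp add: w_def)
  have "(LINT x|\<mu>. (mid b c x) ^ 4) \<le> (LINT x|\<mu>. c * (if \<bar>x\<bar> \<le> c then \<bar>x\<bar> ^ 3 else 0))"
  proof (rule integral_mono)
    fix x :: real
    have "\<bar>x\<bar> * \<bar>x\<bar> ^ 3 \<le> c * \<bar>x\<bar> ^ 3" if "\<bar>x\<bar> \<le> c" using that by (intro mult_right_mono) auto
    moreover have "\<bar>x\<bar> * \<bar>x\<bar> ^ 3 = \<bar>x\<bar> ^ 4" by (simp add: power3_eq_cube power4_eq_xxxx)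
    ultimately show "(mid b c x) ^ 4 \<le> c * (if \<bar>x\<bar> \<le> c then \<bar>x\<bar> ^ 3 else 0)"
      using c by (auto simp: mid_def simp del: power_abs)
  qed (use i[of 4] w_int in auto)
  then show "(LINT x|\<mu>. (mid b c x) ^ 4) \<le> c\<^sup>2 * w c" using c by (simp add: w_def power2_eq_square)
qed

text \<open>
  Markov's inequality for the fourth power of the centred sum; the hypothesis on $n$ says that
  the mean of the sum uses up at most half of $x$.  Second moments would not do when
  $L = \log\log$: they lead to $E[X^2; b < |X| \le c]$, whose sum over the scales may diverge, because
  the interval $(b, c]$ spans a growing number of scales.
\<close>

lemma mid_sum_tail:
  fixes n s :: nat
  assumes b: "b > 0" and c: "c > 0" and x: "x > 0" and n: "n * (\<rho> b / b) \<le> x / 2"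
  shows "prob {\<omega> \<in> space M. x \<le> (\<Sum>j\<in>{s<..s + n}. mid b c (X j \<omega>))}
    \<le> 16 * (real n * (16 * (c\<^sup>2 * w c)) + 3 * (real n)\<^sup>2 * (\<sigma>\<^sup>2 * (w c * c / b))) / x ^ 4"
proof -
  define m where "m = (LINT y|\<mu>. mid b c y)"
  define v where "v = (LINT y|\<mu>. (mid b c y)\<^sup>2)"
  define Z where "Z i \<omega> = mid b c (X i \<omega>) - m" for i \<omega>
  note i = mid_power_int[of b c]
  have mid0: "0 \<le> mid b c y" "mid b c y \<le> c" for y using c by (auto simp: mid_def)
  have m0: "m \<ge> 0" unfolding m_def using mid0 by (intro Bochner_Integration.integral_nonneg)
  have Zb: "\<bar>Z i \<omega>\<bar> \<le> c + m" for i \<omega>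
    using mid0[of "X i \<omega>"] m0 by (simp add: Z_def)
  have v0: "v \<ge> 0" unfolding v_def by (intro Bochner_Integration.integral_nonneg) auto
  have jensen: "(LINT y|\<mu>. f y)\<^sup>2 \<le> (LINT y|\<mu>. (f y)\<^sup>2)" if "integrable \<mu> f" "integrable \<mu> (\<lambda>y. (f y)\<^sup>2)" for f :: "real \<Rightarrow> real"
    using \<mu>.variance_eq[OF that] \<mu>.variance_positive[of f] by simp
  have m2: "m\<^sup>2 \<le> v" unfolding m_def v_def using i[of 1] i[of 2] by (intro jensen) auto
  have "v\<^sup>2 \<le> (LINT y|\<mu>. ((mid b c y)\<^sup>2)\<^sup>2)" unfolding v_def using i[of 2] i[of 4] by (intro jensen) auto
  then have v4: "v\<^sup>2 \<le> (LINT y|\<mu>. (mid b c y) ^ 4)" by simp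
  have m4: "m ^ 4 \<le> (LINT y|\<mu>. (mid b c y) ^ 4)"
  proof -
    have "(m\<^sup>2)\<^sup>2 \<le> v\<^sup>2" using m2 by (intro power_mono) auto
    then show ?thesis using v4 by simp
  qed
  have "expectation (\<lambda>\<omega>. (\<Sum>i\<in>{s<..s + n}. Z i \<omega>) ^ 4) \<le> real n * (16 * (c\<^sup>2 * w c)) + 3 * (real n)\<^sup>2 * v\<^sup>2"
  proof (rule fourth_moment_sum[where K = "c + m"])
    show "indep_vars (\<lambda>_. borel) Z {s<..s + n}"
      unfolding Z_def by (rule indep_image[where f = "\<lambda>y. mid b c y - m"]) measurable
    show "\<bar>Z i \<omega>\<bar> \<le> c + m" for i \<omega> by (rule Zb)
    fix i assume "i \<in> {s<..s + n}"
    then have i1: "i \<ge> 1" by auto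
    have E: "expectation (\<lambda>\<omega>. (Z i \<omega>) ^ p) = (LINT y|\<mu>. (mid b c y - m) ^ p)" for p
      unfolding Z_def using i1 by (intro expectation_X[where f = "\<lambda>y. (mid b c y - m) ^ p"]) auto
    show "expectation (Z i) = 0"
      using E[of 1] i[of 1] by (simp add: m_def[symmetric] \<mu>.prob_space)
    have "(LINT y|\<mu>. (mid b c y - m)\<^sup>2) = (LINT y|\<mu>. (mid b c y)\<^sup>2) - m\<^sup>2"
      using \<mu>.variance_eq[of "mid b c"] i[of 1] i[of 2] by (simp add: m_def)
    then show "expectation (\<lambda>\<omega>. (Z i \<omega>)\<^sup>2) \<le> v" unfolding E v_def by simp
    have "(LINT y|\<mu>. (mid b c y - m) ^ 4) \<le> (LINT y|\<mu>. 8 * (mid b c y) ^ 4 + 8 * m ^ 4)"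
    proof (rule integral_mono')
      show "integrable \<mu> (\<lambda>y. 8 * (mid b c y) ^ 4 + 8 * m ^ 4)" using i[of 4] by simp
      fix y
      define a where "a = mid b c y"
      have "(a - m)\<^sup>2 \<le> 2 * (a\<^sup>2 + m\<^sup>2)"
        using zero_le_power2[of "a + m"] by (simp add: power2_eq_square algebra_simps)
      then have "((a - m)\<^sup>2)\<^sup>2 \<le> (2 * (a\<^sup>2 + m\<^sup>2))\<^sup>2" by (intro power_mono) auto
      also have "\<dots> \<le> 8 * (a\<^sup>2)\<^sup>2 + 8 * (m\<^sup>2)\<^sup>2"
        using zero_le_power2[of "a\<^sup>2 - m\<^sup>2"] by (simp add: power2_eq_square algebra_simps)
      finally show "(mid b c y - m) ^ 4 \<le> 8 * (mid b c y) ^ 4 + 8 * m ^ 4" by (simp add: a_def)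
    qed auto
    also have "\<dots> = 8 * (LINT y|\<mu>. (mid b c y) ^ 4) + 8 * m ^ 4"
      using i[of 4] by (simp add: \<mu>.prob_space)
    also have "\<dots> \<le> 16 * (LINT y|\<mu>. (mid b c y) ^ 4)" using m4 by simp
    also have "\<dots> \<le> 16 * (c\<^sup>2 * w c)" using mid_moments(4)[OF b c] by simp
    finally show "expectation (\<lambda>\<omega>. (Z i \<omega>) ^ 4) \<le> 16 * (c\<^sup>2 * w c)" unfolding E .
  qed (rule v0)
  also have "v\<^sup>2 \<le> \<sigma>\<^sup>2 * (w c * c / b)"
    unfolding power2_eq_square[of v] using mid_moments(2,3)[OF b c] v0 by (intro mult_mono) (auto simp: v_def)
  finally have E4: "expectation (\<lambda>\<omega>. (\<Sum>i\<in>{s<..s + n}. Z i \<omega>) ^ 4)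
      \<le> real n * (16 * (c\<^sup>2 * w c)) + 3 * (real n)\<^sup>2 * (\<sigma>\<^sup>2 * (w c * c / b))"
    by (simp add: mult_left_mono)
  have Zm[measurable]: "Z i \<in> borel_measurable M" if "i \<in> {s<..s + n}" for i
  proof -
    have [measurable]: "X i \<in> borel_measurable M" using that by (intro X_meas) auto
    show ?thesis unfolding Z_def by measurable
  qed
  have sub: "{\<omega> \<in> space M. x \<le> (\<Sum>j\<in>{s<..s + n}. mid b c (X j \<omega>))}
      \<subseteq> {\<omega> \<in> space M. (x / 2) ^ 4 \<le> (\<Sum>i\<in>{s<..s + n}. Z i \<omega>) ^ 4}"
  proof safe
    fix \<omega> assume h: "x \<le> (\<Sum>j\<in>{s<..s + n}. mid b c (X j \<omega>))"
    have "n * m \<le> n * (\<rho> b / b)" using mid_moments(1)[OF b c] by (intro mult_left_mono) (auto simp: m_def)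
    moreover have "(\<Sum>i\<in>{s<..s + n}. Z i \<omega>) = (\<Sum>j\<in>{s<..s + n}. mid b c (X j \<omega>)) - n * m"
      by (simp add: Z_def sum_subtractf)
    ultimately have "x / 2 \<le> (\<Sum>i\<in>{s<..s + n}. Z i \<omega>)" using h n by linarith
    then show "(x / 2) ^ 4 \<le> (\<Sum>i\<in>{s<..s + n}. Z i \<omega>) ^ 4" using x by (intro power_mono) auto
  qed
  have "prob {\<omega> \<in> space M. x \<le> (\<Sum>j\<in>{s<..s + n}. mid b c (X j \<omega>))}
      \<le> prob {\<omega> \<in> space M. (x / 2) ^ 4 \<le> (\<Sum>i\<in>{s<..s + n}. Z i \<omega>) ^ 4}"
    by (intro finite_measure_mono sub) measurable
  also have "\<dots> \<le> expectation (\<lambda>\<omega>. (\<Sum>i\<in>{s<..s + n}. Z i \<omega>) ^ 4) / (x / 2) ^ 4"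
  proof (rule integral_Markov_inequality_measure[where A = "{}"])
    show "integrable M (\<lambda>\<omega>. (\<Sum>i\<in>{s<..s + n}. Z i \<omega>) ^ 4)"
    proof (rule integrable_const_bound[where B = "(n * (c + m)) ^ 4"])
      have "\<bar>\<Sum>i\<in>{s<..s + n}. Z i \<omega>\<bar> \<le> n * (c + m)" for \<omega>
      proof -
        have "\<bar>\<Sum>i\<in>{s<..s + n}. Z i \<omega>\<bar> \<le> (\<Sum>i\<in>{s<..s + n}. c + m)"
          using Zb by (intro order.trans[OF sum_abs] sum_mono) auto
        then show ?thesis by simp
      qed
      then show "AE \<omega> in M. norm ((\<Sum>i\<in>{s<..s + n}. Z i \<omega>) ^ 4) \<le> (n * (c + m)) ^ 4"
        by (intro AE_I2) (simp only: real_norm_def power_abs, intro power_mono, auto)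
    qed measurable
  qed (use x in auto)
  also have "\<dots> = 16 * expectation (\<lambda>\<omega>. (\<Sum>i\<in>{s<..s + n}. Z i \<omega>) ^ 4) / x ^ 4"
    using x by (simp add: power_divide)
  also have "\<dots> \<le> 16 * (real n * (16 * (c\<^sup>2 * w c)) + 3 * (real n)\<^sup>2 * (\<sigma>\<^sup>2 * (w c * c / b))) / x ^ 4"
    using E4 x by (intro divide_right_mono mult_left_mono) auto
  finally show ?thesis .
qed

text \<open>
  Borel-Cantelli: $\sum_i P(4 X^2 > i) \le 4 E X^2$.
\<close>

lemma AE_eventually_small: "AE \<omega> in M. eventually (\<lambda>i. \<bar>X i \<omega>\<bar> \<le> sqrt i / 2) sequentially"
proof -
  define A where "A i = {x::real. sqrt (real i) / 2 < \<bar>x\<bar>}" for i :: nat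
  have A_b[measurable]: "A i \<in> sets borel" for i unfolding A_def by measurable
  have sm: "summable (\<lambda>i. measure \<mu> (A (Suc i)))"
  proof (rule summableI_nonneg_bounded)
    fix K
    have "(\<Sum>i<K. measure \<mu> (A (Suc i))) = (LINT x|\<mu>. (\<Sum>i<K. indicator (A (Suc i)) x))"
    proof (subst Bochner_Integration.integral_sum)
      show "integrable \<mu> (indicator (A (Suc i)) :: real \<Rightarrow> real)" for i
        by (intro integrable_real_indicator) (auto simp: \<mu>.emeasure_eq_measure sets_\<mu>)
      show "(\<Sum>i<K. measure \<mu> (A (Suc i))) = (\<Sum>i<K. LINT x|\<mu>. indicator (A (Suc i)) x)"
        by (intro sum.cong refl) (simp add: sets_eq_imp_space_eq[OF sets_\<mu>])
    qed
    also have "\<dots> \<le> (LINT x|\<mu>. 4 * x\<^sup>2)"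
    proof (rule integral_mono')
      show "integrable \<mu> (\<lambda>x. 4 * x\<^sup>2)" using sq_int by simp
      fix x :: real
      have iff: "x \<in> A (Suc i) \<longleftrightarrow> real (Suc i) < 4 * x\<^sup>2" for i
      proof -
        have "x \<in> A (Suc i) \<longleftrightarrow> sqrt (real (Suc i)) < sqrt ((2 * x)\<^sup>2)"
          unfolding real_sqrt_abs by (simp add: A_def abs_mult mult.commute)
        also have "\<dots> \<longleftrightarrow> real (Suc i) < 4 * x\<^sup>2" by (simp only: real_sqrt_less_iff) (simp add: power_mult_distrib)
        finally show ?thesis .
      qed
      have "(\<Sum>i<K. indicator (A (Suc i)) x) = (\<Sum>i<K. if real (Suc i) < 4 * x\<^sup>2 then 1 else (0::real))"
        by (intro sum.cong) (auto simp: iff indicator_def)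
      also have "\<dots> = card {i. i < K \<and> real (Suc i) < 4 * x\<^sup>2}"
        by (simp add: sum.If_cases) (rule arg_cong[where f = card], auto)
      also have "\<dots> \<le> card {..<nat \<lfloor>4 * x\<^sup>2\<rfloor>}"
        by (intro of_nat_mono card_mono) (auto, linarith)
      also have "\<dots> \<le> 4 * x\<^sup>2" by simp
      finally show "(\<Sum>i<K. indicator (A (Suc i)) x) \<le> 4 * x\<^sup>2" .
      show "0 \<le> 4 * x\<^sup>2" by simp
    qed
    finally show "(\<Sum>i<K. measure \<mu> (A (Suc i))) \<le> (LINT x|\<mu>. 4 * x\<^sup>2)" .
  qed auto
  define E where "E i = {\<omega> \<in> space M. X (Suc i) \<omega> \<in> A (Suc i)}" for i
  have E_meas: "E i \<in> sets M" for i
  proof -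
    have [measurable]: "X (Suc i) \<in> borel_measurable M" by (intro X_meas) auto
    show ?thesis unfolding E_def by measurable
  qed
  have pE: "prob (E i) = measure \<mu> (A (Suc i))" for i
    unfolding E_def by (intro prob_X) auto
  have "AE \<omega> in M. eventually (\<lambda>i. \<omega> \<in> space M - E i) sequentially"
    using sm by (intro borel_cantelli_AE1 E_meas) (auto simp: pE emeasure_eq_measure)
  then show ?thesis
  proof (eventually_elim)
    case (elim \<omega>)
    then have "eventually (\<lambda>i. \<bar>X (Suc i) \<omega>\<bar> \<le> sqrt (Suc i) / 2) sequentially"
      by eventually_elim (auto simp: E_def A_def)
    then show ?case using eventually_sequentially_Suc[of "\<lambda>i. \<bar>X i \<omega>\<bar> \<le> sqrt (real i) / 2"] by blast
  qed
qed

end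

section \<open>Moderate deviations from below\<close>

lemma measure_std_normal_singleton: "measure std_normal_distribution {x} = 0"
proof -
  have "emeasure std_normal_distribution {x} = (\<integral>\<^sup>+ y. ennreal (std_normal_density y) * indicator {x} y \<partial>lborel)"
    by (subst emeasure_density) auto
  also have "\<dots> = (\<integral>\<^sup>+ (y::real). 0 \<partial>lborel)"
  proof (rule nn_integral_cong_AE)
    have "AE y in lborel. y \<noteq> x" by (rule AE_lborel_singleton)
    then show "AE y in lborel. ennreal (std_normal_density y) * indicator {x} y = 0"
      by eventually_elim auto
  qed
  finally show ?thesis by (simp add: measure_def)
qed

lemma std_normal_tail_lower:
  assumes "y \<ge> 0"
  shows "exp (- (y + 1)\<^sup>2 / 2) / sqrt (2 * pi) \<le> measure std_normal_distribution {y<..}"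
proof -
  interpret N: real_distribution std_normal_distribution by (rule real_dist_normal_dist)
  define C where "C = exp (- (y + 1)\<^sup>2 / 2) / sqrt (2 * pi)"
  have "ennreal C = (\<integral>\<^sup>+ z. ennreal C * indicator {y<..y + 1} z \<partial>lborel)"
    by (subst nn_integral_cmult_indicator) (auto simp: C_def)
  also have "\<dots> \<le> (\<integral>\<^sup>+ z. ennreal (std_normal_density z) * indicator {y<..} z \<partial>lborel)"
  proof (rule nn_integral_mono)
    fix z :: real
    have "C \<le> std_normal_density z" if "z \<in> {y<..y + 1}"
    proof -
      have "z\<^sup>2 \<le> (y + 1)\<^sup>2" using that assms by (intro power_mono) auto
      then show ?thesis by (auto simp: C_def std_normal_density_def divide_right_mono)
    qed
    then show "ennreal C * indicator {y<..y + 1} z \<le> ennreal (std_normal_density z) * indicator {y<..} z"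
      by (auto simp: indicator_def intro!: ennreal_leI)
  qed
  also have "\<dots> = emeasure std_normal_distribution {y<..}"
    by (subst emeasure_density) auto
  finally show ?thesis by (simp add: C_def N.emeasure_eq_measure)
qed

context iid_seq
begin

definition tail :: "nat \<Rightarrow> real \<Rightarrow> real" where
  "tail n z = prob {\<omega> \<in> space M. z \<le> (\<Sum>j\<in>{0<..n}. X j \<omega>)}"

lemma block_meas: "(\<lambda>\<omega>. \<Sum>j\<in>{s<..n}. X j \<omega>) \<in> borel_measurable M"
  by (intro borel_measurable_sum X_meas) auto

text \<open>
  Stationarity, read off from characteristic functions.
\<close>

lemma prob_block_sum: "prob {\<omega> \<in> space M. z \<le> (\<Sum>j\<in>{s<..s + n}. X j \<omega>)} = tail n z"
proof -
  let ?D = "\<lambda>s. distr M borel (\<lambda>\<omega>. \<Sum>j\<in>{s<..s + n}. X j \<omega>)"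
  have ch: "char (?D s) = (\<lambda>t. char \<mu> t ^ n)" for s
  proof
    fix t
    have "char (?D s) t = (\<Prod>i\<in>{s<..s + n}. char (distr M borel (X i)) t)"
      by (intro char_distr_sum indep_vars_subset[OF indep_X]) auto
    also have "\<dots> = (\<Prod>i\<in>{s<..s + n}. char \<mu> t)"
      by (intro prod.cong) (auto simp: distr_X)
    finally show "char (?D s) t = char \<mu> t ^ n" by simp
  qed
  have rd: "real_distribution (?D s)" for s by (intro real_distribution_distr block_meas)
  have eq: "?D s = ?D 0" by (rule Levy_uniqueness[OF rd rd]) (simp only: ch)
  have m: "prob {\<omega> \<in> space M. z \<le> (\<Sum>j\<in>{s<..s + n}. X j \<omega>)} = measure (?D s) {z..}" for s
    by (subst measure_distr[OF block_meas]) (auto intro!: arg_cong[where f = prob])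
  show ?thesis unfolding m eq tail_def using m[of 0] by simp
qed

lemma indep_disjoint_blocks:
  assumes "disjoint_family K" "\<And>k. K k \<subseteq> {1..}"
  shows "indep_vars (\<lambda>_. borel) (\<lambda>k \<omega>. \<Sum>j\<in>K k. X j \<omega>) UNIV"
proof -
  have "indep_vars (\<lambda>k. PiM (K k) (\<lambda>_. borel)) (\<lambda>k \<omega>. restrict (\<lambda>i. X i \<omega>) (K k)) UNIV"
    using assms by (intro indep_vars_restrict[OF indep_X]) auto
  then have "indep_vars (\<lambda>_. borel) (\<lambda>k \<omega>. (\<lambda>f. \<Sum>j\<in>K k. f j) (restrict (\<lambda>i. X i \<omega>) (K k))) UNIV"
    by (rule indep_vars_compose2) auto
  then show ?thesis by (simp cong: sum.cong)
qed

lemma tail_add: "tail n1 z1 * tail n2 z2 \<le> tail (n1 + n2) (z1 + z2)"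
proof -
  define S where "S \<omega> = (\<Sum>j\<in>{0<..n1}. X j \<omega>)" for \<omega>
  define T where "T \<omega> = (\<Sum>j\<in>{n1<..n1 + n2}. X j \<omega>)" for \<omega>
  have "indep_var (PiM {0<..n1} (\<lambda>_. borel)) (\<lambda>\<omega>. restrict (\<lambda>i. X i \<omega>) {0<..n1})
      (PiM {n1<..n1 + n2} (\<lambda>_. borel)) (\<lambda>\<omega>. restrict (\<lambda>i. X i \<omega>) {n1<..n1 + n2})"
    by (rule indep_var_restrict[OF indep_X]) auto
  then have "indep_var borel ((\<lambda>f. \<Sum>j\<in>{0<..n1}. f j) \<circ> (\<lambda>\<omega>. restrict (\<lambda>i. X i \<omega>) {0<..n1}))
      borel ((\<lambda>f. \<Sum>j\<in>{n1<..n1 + n2}. f j) \<circ> (\<lambda>\<omega>. restrict (\<lambda>i. X i \<omega>) {n1<..n1 + n2}))"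
    by (rule indep_var_compose) auto
  moreover have "(\<lambda>f. \<Sum>j\<in>I. f j) \<circ> (\<lambda>\<omega>. restrict (\<lambda>i. X i \<omega>) I) = (\<lambda>\<omega>. \<Sum>j\<in>I. X j \<omega>)" for I
    by (auto simp: comp_def fun_eq_iff intro!: sum.cong)
  ultimately have iv: "indep_var borel S borel T"
    unfolding S_def[abs_def] T_def[abs_def] by simp
  have [measurable]: "S \<in> borel_measurable M" "T \<in> borel_measurable M"
    unfolding S_def T_def using block_meas[of 0] block_meas by auto
  have "tail n1 z1 * tail n2 z2 = prob {\<omega> \<in> space M. z1 \<le> S \<omega>} * prob {\<omega> \<in> space M. z2 \<le> T \<omega>}"
    unfolding tail_def[of n1] S_def T_def by (simp add: prob_block_sum)
  also have "\<dots> = prob {\<omega> \<in> space M. S \<omega> \<in> {z1..} \<and> T \<omega> \<in> {z2..}}"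
    by (subst prob_indep_random_variable[OF iv]) auto
  also have "\<dots> \<le> tail (n1 + n2) (z1 + z2)"
    unfolding tail_def
  proof (rule finite_measure_mono)
    have "(\<Sum>j\<in>{0<..n1 + n2}. X j \<omega>) = S \<omega> + T \<omega>" for \<omega>
    proof -
      have "{0<..n1 + n2} = {0<..n1} \<union> {n1<..n1 + n2}" by auto
      then show ?thesis unfolding S_def T_def by (simp only:) (subst sum.union_disjoint, auto)
    qed
    then show "{\<omega> \<in> space M. S \<omega> \<in> {z1..} \<and> T \<omega> \<in> {z2..}} \<subseteq> {\<omega> \<in> space M. z1 + z2 \<le> (\<Sum>j\<in>{0<..n1 + n2}. X j \<omega>)}"
      by auto
    show "{\<omega> \<in> space M. z1 + z2 \<le> (\<Sum>j\<in>{0<..n1 + n2}. X j \<omega>)} \<in> sets M"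
      using block_meas[of 0 "n1 + n2"] by measurable
  qed
  finally show ?thesis .
qed

text \<open>
  Pieces of one length \<open>l\<close> and a last, longer piece \<open>l'\<close> that takes up the remainder of a division.
\<close>

lemma tail_power:
  fixes z :: real
  assumes "p \<ge> 0" "p \<le> tail l z" "p \<le> tail l' z"
  shows "p ^ Suc i \<le> tail (i * l + l') (Suc i * z)"
proof (induction i)
  case 0 then show ?case using assms by simp
next
  case (Suc i)
  have "p ^ Suc (Suc i) = p * p ^ Suc i" by simp
  also have "\<dots> \<le> tail l z * tail (i * l + l') (Suc i * z)"
    using assms Suc by (intro mult_mono) (auto simp: tail_def)
  also have "\<dots> \<le> tail (l + (i * l + l')) (z + Suc i * z)" by (rule tail_add)
  also have "l + (i * l + l') = Suc i * l + l'" by simp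
  also have "z + Suc i * z = Suc (Suc i) * z" by (simp add: algebra_simps)
  finally show ?case .
qed

text \<open>
  The central limit theorem, applied to the sequence with its index shifted to start at 0.
\<close>

lemma tail_clt:
  assumes "p < measure std_normal_distribution {y<..}"
  shows "eventually (\<lambda>n. p \<le> tail n (y * \<sigma> * sqrt n)) sequentially"
proof -
  interpret N: real_distribution std_normal_distribution by (rule real_dist_normal_dist)
  define X' where "X' i = X (Suc i)" for i
  define D where "D n = distr M borel (\<lambda>\<omega>. (\<Sum>i<n. X' i \<omega>) / sqrt (n * \<sigma>\<^sup>2))" for n
  have sum_eq: "(\<Sum>i<n. X' i \<omega>) = (\<Sum>j\<in>{0<..n}. X j \<omega>)" for n \<omega>
    unfolding X'_def by (rule sum.reindex_bij_witness[where i = "\<lambda>j. j - 1" and j = Suc]) auto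
  have "weak_conv_m D std_normal_distribution"
    unfolding D_def
  proof (rule central_limit_theorem_zero_mean[where \<mu> = \<mu>])
    show "indep_vars (\<lambda>i. borel) X' UNIV"
    proof -
      have "indep_vars (\<lambda>_. borel) (\<lambda>k \<omega>. \<Sum>j\<in>{Suc k}. X j \<omega>) UNIV"
        by (rule indep_disjoint_blocks) (auto simp: disjoint_family_on_def)
      then show ?thesis by (simp add: X'_def[abs_def])
    qed
    have E: "expectation (\<lambda>\<omega>. f (X' n \<omega>)) = (LINT x|\<mu>. f x)" if "f \<in> borel_measurable borel" for f :: "real \<Rightarrow> real" and n
      unfolding X'_def using that by (intro expectation_X) auto
    show e0: "expectation (X' n) = 0" for n using E[of "\<lambda>x. x"] mean0 by simp
    show "integrable M (\<lambda>x. (X' n x)\<^sup>2)" for n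
      unfolding X'_def by (rule integrable_X[where f = "\<lambda>x. x\<^sup>2"]) (use sq_int in auto)
    show "variance (X' n) = \<sigma>\<^sup>2" for n using E[of "\<lambda>x. x\<^sup>2"] var by (simp add: e0)
    show "distr M borel (X' n) = \<mu>" for n by (simp add: X'_def distr_X)
  qed (rule \<sigma>_pos)
  then have lim: "(\<lambda>n. cdf (D n) y) \<longlonglongrightarrow> cdf std_normal_distribution y"
    unfolding weak_conv_m_def weak_conv_def using N.isCont_cdf measure_std_normal_singleton by blast
  have compl: "measure std_normal_distribution {y<..} = 1 - cdf std_normal_distribution y"
  proof -
    have "measure std_normal_distribution {y<..} = measure std_normal_distribution (space std_normal_distribution - {..y})"
      by (rule arg_cong[where f = "measure _"]) auto
    also have "\<dots> = 1 - cdf std_normal_distribution y" unfolding cdf_def by (rule N.prob_compl) simp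
    finally show ?thesis .
  qed
  have "eventually (\<lambda>n. cdf (D n) y < 1 - p) sequentially"
    using assms compl by (intro order_tendstoD(2)[OF lim]) auto
  moreover have "eventually (\<lambda>n. n > 0) sequentially" by (rule eventually_gt_at_top)
  ultimately show ?thesis
  proof eventually_elim
    case (elim n)
    have [measurable]: "(\<lambda>\<omega>. \<Sum>j\<in>{0<..n}. X j \<omega>) \<in> borel_measurable M" by (rule block_meas)
    have r: "sqrt (n * \<sigma>\<^sup>2) = \<sigma> * sqrt n" using \<sigma>_pos by (simp add: real_sqrt_mult)
    have pos: "\<sigma> * sqrt n > 0" using \<sigma>_pos elim by simp
    have "p < 1 - cdf (D n) y" using elim by simp
    also have "cdf (D n) y = prob {\<omega> \<in> space M. (\<Sum>j\<in>{0<..n}. X j \<omega>) \<le> y * \<sigma> * sqrt n}"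
      unfolding cdf_def D_def r sum_eq
      by (subst measure_distr) (use pos in \<open>auto intro!: arg_cong[where f = prob] simp: field_simps\<close>)
    also have "1 - \<dots> = prob (space M - {\<omega> \<in> space M. (\<Sum>j\<in>{0<..n}. X j \<omega>) \<le> y * \<sigma> * sqrt n})"
      by (subst prob_compl) auto
    also have "\<dots> \<le> tail n (y * \<sigma> * sqrt n)"
      unfolding tail_def by (intro finite_measure_mono) auto
    finally show ?case by simp
  qed
qed

text \<open>
  Cutting $a$ summands into $r = \lceil x / K \rceil$ pieces of length about $a / r$, each
  piece has to exceed $(1-\epsilon)\sigma\sqrt{2Ax}/r$, which is less than
  $(1 - \epsilon/2)\sqrt{2K}$ standard deviations of a piece.  By the central limit theorem this has
  probability at least $e^{-(1-\epsilon/2)K}$ once $K$ is large and the pieces are longer than some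
  $l_0$.  The real number $A$ is allowed to exceed the integer $a$ by the rounding of the window
  length.
\<close>

lemma tail_moderate_deviation:
  assumes \<epsilon>: "0 < \<epsilon>" "\<epsilon> < 1"
  shows "\<exists>K\<ge>1. \<exists>l0::nat. \<forall>x\<ge>1. \<forall>a::nat. \<forall>A::real. real l0 * (x + 1) \<le> a \<longrightarrow> A \<le> real a + 1 \<longrightarrow>
    exp (- K) * exp (- (1 - \<epsilon> / 2) * x) \<le> tail a ((1 - \<epsilon>) * \<sigma> * sqrt (2 * A * x))"
proof -
  define g where "g = 1 - \<epsilon> / 2"
  have g: "0 < g" "g < 1" using \<epsilon> by (auto simp: g_def)
  define h where "h = g * (1 - g)"
  have h: "h > 0" using g by (simp add: h_def)
  \<comment> \<open>the Gaussian exponent at $g\sqrt{2K}$ is $g^2 K + O(\sqrt K)$, which stays below $g K$ because $g < 1$\<close>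
  have "eventually (\<lambda>K. h * K > g * sqrt (2 * K) + 5 / 2) at_top"
    using g h by real_asymp
  then have "eventually (\<lambda>K. exp (- g * K) < exp (- (g * sqrt (2 * K) + 1)\<^sup>2 / 2) / sqrt (2 * pi)) at_top"
    using eventually_ge_at_top[of 0]
  proof eventually_elim
    case (elim K)
    have "(g * sqrt (2 * K) + 1)\<^sup>2 / 2 = g\<^sup>2 * K + g * sqrt (2 * K) + 1 / 2"
      using elim by (simp add: power2_sum power_mult_distrib field_simps)
    moreover have "g * K = h * K + g\<^sup>2 * K" by (simp add: h_def power2_eq_square algebra_simps)
    ultimately have "- g * K + 2 < - (g * sqrt (2 * K) + 1)\<^sup>2 / 2" using elim by linarith
    then have 1: "exp (- g * K) * exp 2 < exp (- (g * sqrt (2 * K) + 1)\<^sup>2 / 2)"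
      by (simp add: exp_add[symmetric])
    have "sqrt (2 * pi) \<le> exp 2"
    proof -
      have "sqrt (2 * pi) \<le> sqrt (3\<^sup>2)" using pi_less_4 by (intro real_sqrt_le_mono) simp
      then show ?thesis using exp_ge_add_one_self[of 2] by simp
    qed
    then have "exp (- g * K) * sqrt (2 * pi) \<le> exp (- g * K) * exp 2" by (intro mult_left_mono) auto
    with 1 have "exp (- g * K) * sqrt (2 * pi) < exp (- (g * sqrt (2 * K) + 1)\<^sup>2 / 2)" by linarith
    then show ?case by (simp add: pos_less_divide_eq)
  qed
  then have "eventually (\<lambda>K. K \<ge> 1 \<and> exp (- g * K) < exp (- (g * sqrt (2 * K) + 1)\<^sup>2 / 2) / sqrt (2 * pi)) at_top"
    using eventually_ge_at_top by (rule eventually_conj[rotated])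
  then obtain K where K: "K \<ge> 1" "exp (- g * K) < exp (- (g * sqrt (2 * K) + 1)\<^sup>2 / 2) / sqrt (2 * pi)"
    using eventually_happens'[OF trivial_limit_at_top_linorder] by blast
  define y where "y = g * sqrt (2 * K)"
  define p where "p = exp (- g * K)"
  have y0: "y > 0" using g K by (simp add: y_def)
  have "p < measure std_normal_distribution {y<..}"
    using std_normal_tail_lower[of y] y0 K by (simp add: y_def p_def)
  from tail_clt[OF this] obtain l1 where l1: "\<And>n. n \<ge> l1 \<Longrightarrow> p \<le> tail n (y * \<sigma> * sqrt n)"
    by (auto simp: eventually_sequentially)
  define l0 where "l0 = max (max l1 1) (nat \<lceil>4 / \<epsilon>\<rceil>)"
  have l0: "l0 \<ge> l1" "l0 \<ge> 1" "real l0 \<ge> 4 / \<epsilon>" by (auto simp: l0_def) linarith+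
  have tail_mono: "tail n z \<le> tail n z'" if "z' \<le> z" for n z z'
    unfolding tail_def using that block_meas[of 0 n] by (intro finite_measure_mono) auto
  show ?thesis
  proof (intro exI[of _ K] conjI exI[of _ l0] allI impI K(1))
    fix x A :: real and a :: nat
    assume x: "x \<ge> 1" and a: "real l0 * (x + 1) \<le> a" and A: "A \<le> real a + 1"
    define r where "r = nat \<lceil>x / K\<rceil>"
    have xK: "x / K > 0" using x K by simp
    then have r1: "r \<ge> 1" by (simp add: r_def Suc_le_eq)
    have rx: "x / K \<le> r" "r \<le> x / K + 1" using xK by (auto simp: r_def)
    have "x / K \<le> x / 1" using x K by (intro divide_left_mono) auto
    then have "r \<le> x + 1" using rx by simp
    then have "l0 * real r \<le> l0 * (x + 1)" by (intro mult_left_mono) auto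
    then have "real (l0 * r) \<le> real a" using a by simp
    then have l0r: "l0 * r \<le> a" by linarith
    define l where "l = a div r"
    have ll: "l0 \<le> l" using l0r r1 by (simp add: l_def less_eq_div_iff_mult_less_eq)
    define l' where "l' = l + a mod r"
    have adec: "a = (r - 1) * l + l'"
    proof -
      have "a = r * l + a mod r" by (simp add: l_def)
      also have "r * l = (r - 1) * l + l" using r1 by (metis Suc_diff_1 mult_Suc add.commute less_le_trans zero_less_one)
      finally show ?thesis by (simp add: l'_def)
    qed
    have rl: "real a - r \<le> real r * l"
    proof -
      have "a = r * l + a mod r" by (simp add: l_def)
      moreover have "a mod r < r" using r1 by simp
      ultimately have "a \<le> r * l + r" by linarith
      then have "real a \<le> real (r * l + r)" by linarith
      then show ?thesis by simp
    qed
    define z where "z = y * \<sigma> * sqrt l"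
    have p1: "p \<le> tail l z" unfolding z_def using ll l0 by (intro l1) auto
    have "p \<le> tail l' (y * \<sigma> * sqrt l')" using ll l0 by (intro l1) (auto simp: l'_def)
    also have "\<dots> \<le> tail l' z"
      unfolding z_def using y0 \<sigma>_pos by (intro tail_mono mult_left_mono) (auto simp: l'_def)
    finally have p2: "p \<le> tail l' z" .
    have "p ^ Suc (r - 1) \<le> tail ((r - 1) * l + l') (Suc (r - 1) * z)"
      by (rule tail_power[OF _ p1 p2]) (simp add: p_def)
    then have main: "p ^ r \<le> tail a (r * z)" using r1 adec by simp
    have "exp (- K) * exp (- (1 - \<epsilon> / 2) * x) = exp (- K - g * x)"
      by (simp add: exp_add[symmetric] g_def algebra_simps)
    also have "\<dots> \<le> exp (- (g * K * r))"
    proof -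
      have "K * r \<le> K * (x / K + 1)" using rx K by (intro mult_left_mono) auto
      also have "\<dots> = x + K" using K by (simp add: distrib_left)
      finally have "g * (K * r) \<le> g * (x + K)" using g by (intro mult_left_mono) auto
      moreover have "g * K \<le> 1 * K" using g K by (intro mult_right_mono) auto
      ultimately show ?thesis by (simp add: algebra_simps)
    qed
    also have "\<dots> = p ^ r" by (simp add: p_def exp_of_nat_mult[symmetric] mult_ac)
    also have "\<dots> \<le> tail a (r * z)" by (rule main)
    also have "\<dots> \<le> tail a ((1 - \<epsilon>) * \<sigma> * sqrt (2 * A * x))"
    proof (rule tail_mono)
      have ar: "real r + 1 \<le> (\<epsilon> / 2) * a"
      proof -
        have "real r + 1 \<le> 2 * r" using r1 by simp
        also have "\<dots> = (\<epsilon> / 2) * ((4 / \<epsilon>) * r)" using \<epsilon> by simp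
        also have "\<dots> \<le> (\<epsilon> / 2) * (l0 * r)"
        proof (rule mult_left_mono)
          show "4 / \<epsilon> * r \<le> real (l0 * r)" unfolding of_nat_mult using l0 by (intro mult_right_mono) auto
        qed (use \<epsilon> in auto)
        also have "\<dots> \<le> (\<epsilon> / 2) * a" using \<epsilon> l0r \<open>real (l0 * r) \<le> real a\<close> by (intro mult_left_mono) auto
        finally show ?thesis .
      qed
      have "(1 - \<epsilon>)\<^sup>2 * A \<le> (1 - \<epsilon>)\<^sup>2 * (real a + 1)" using A by (intro mult_left_mono) auto
      also have "\<dots> \<le> (g\<^sup>2 * g) * (real a + 1)"
      proof (rule mult_right_mono)
        have "1 - \<epsilon> \<le> g\<^sup>2" using \<epsilon> by (simp add: g_def power2_eq_square algebra_simps)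
        moreover have "1 - \<epsilon> \<le> g" using \<epsilon> by (simp add: g_def)
        ultimately show "(1 - \<epsilon>)\<^sup>2 \<le> g\<^sup>2 * g" unfolding power2_eq_square[of "1 - \<epsilon>"]
          using \<epsilon> g by (intro mult_mono) auto
      qed auto
      also have "\<dots> \<le> g\<^sup>2 * (r * l)"
      proof -
        have "g * (real a + 1) \<le> real a - real r"
        proof -
          have "g * (real a + 1) = real a + 1 - \<epsilon> / 2 * a - \<epsilon> / 2" by (simp add: g_def algebra_simps)
          then show ?thesis using ar \<epsilon> by simp
        qed
        also have "\<dots> \<le> r * l" using rl by simp
        finally show ?thesis using g unfolding mult.assoc by (intro mult_left_mono) auto
      qed
      finally have 1: "(1 - \<epsilon>)\<^sup>2 * A \<le> g\<^sup>2 * (r * l)" .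
      have "(1 - \<epsilon>) * sqrt (2 * A * x) = sqrt ((1 - \<epsilon>)\<^sup>2 * A * (2 * x))"
        using \<epsilon> by (simp add: real_sqrt_mult mult_ac)
      also have "\<dots> \<le> sqrt (g\<^sup>2 * (r * l) * (2 * (K * r)))"
      proof (rule real_sqrt_le_mono, rule mult_mono[OF 1])
        show "2 * x \<le> 2 * (K * r)" using rx K by (simp add: field_simps)
      qed (use x in auto)
      also have "g\<^sup>2 * (r * l) * (2 * (K * r)) = (r * g)\<^sup>2 * (2 * K * l)"
        by (simp add: power2_eq_square)
      also have "sqrt \<dots> = r * (y * sqrt l)"
        using g by (simp add: real_sqrt_mult y_def)
      finally have "\<sigma> * ((1 - \<epsilon>) * sqrt (2 * A * x)) \<le> \<sigma> * (r * (y * sqrt l))"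
        using \<sigma>_pos by (intro mult_left_mono) auto
      then show "(1 - \<epsilon>) * \<sigma> * sqrt (2 * A * x) \<le> r * z" by (simp add: z_def mult_ac)
    qed
    finally show "exp (- K) * exp (- (1 - \<epsilon> / 2) * x) \<le> tail a ((1 - \<epsilon>) * \<sigma> * sqrt (2 * A * x))" .
  qed
qed

end

locale iid_slow = iid_seq M X \<mu> \<sigma> + slow_scale L
  for M :: "'a measure" and X \<mu> \<sigma> L
begin

definition window :: "nat \<Rightarrow> nat" where
  "window n = nat \<lfloor>n / L n\<rfloor>"

lemma filterlim_pow2: "filterlim (\<lambda>k. 2 ^ k :: real) at_top sequentially"
  by real_asymp

text \<open>
  As soon as $L \ge 1$, the window at $n = 2^k$ ends by $2^{k+1}$; these windows are therefore disjoint,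
  and their sums independent.
\<close>

lemma delayed_sum_frequently_ge:
  assumes \<epsilon>: "0 < \<epsilon>" "\<epsilon> < 1"
  shows "AE \<omega> in M. \<exists>\<^sub>F n in sequentially.
    (1 - \<epsilon>) * \<sigma> * sqrt (2 * (n / L n) * ln (ln n)) \<le> (\<Sum>j\<in>{n<..n + window n}. X j \<omega>)"
proof -
  from tail_moderate_deviation[OF \<epsilon>] obtain K and l0 :: nat where K: "K \<ge> 1"
    and td0: "\<forall>x\<ge>1. \<forall>a::nat. \<forall>A::real. real l0 * (x + 1) \<le> a \<longrightarrow> A \<le> real a + 1 \<longrightarrow>
      exp (- K) * exp (- (1 - \<epsilon> / 2) * x) \<le> tail a ((1 - \<epsilon>) * \<sigma> * sqrt (2 * A * x))"
    by (elim exE conjE)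
  note td = td0[rule_format]
  have "eventually (\<lambda>x::real. x \<ge> 1 \<and> L x \<ge> 1 \<and> L x \<le> ln (ln x) \<and> ln (ln x) \<ge> 1 \<and>
      (l0 * (ln (ln x) + 1) + 1) * ln (ln x) \<le> x) at_top"
  proof (intro eventually_conj L_le_lnln)
    show "eventually (\<lambda>x. L x \<ge> 1) at_top" using L_at_top by (auto simp: filterlim_at_top)
    have "((\<lambda>x::real. (ln (ln x) + 1) * ln (ln x) / x) \<longlongrightarrow> 0) at_top" by real_asymp
    then have "eventually (\<lambda>x::real. (ln (ln x) + 1) * ln (ln x) / x < 1 / (l0 + 1)) at_top"
      by (rule order_tendstoD(2)) auto
    moreover have "eventually (\<lambda>x::real. ln (ln x) \<ge> 1) at_top" by real_asymp
    moreover have "eventually (\<lambda>x::real. x > 0) at_top" by (rule eventually_gt_at_top)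
    ultimately show "eventually (\<lambda>x::real. (l0 * (ln (ln x) + 1) + 1) * ln (ln x) \<le> x) at_top"
    proof eventually_elim
      case (elim x)
      have "(l0 * (ln (ln x) + 1) + 1) * ln (ln x) \<le> ((l0 + 1) * (ln (ln x) + 1)) * ln (ln x)"
        using elim by (intro mult_right_mono) (auto simp: algebra_simps)
      also have "\<dots> \<le> x" using elim by (simp add: field_simps)
      finally show ?case .
    qed
    show "eventually (\<lambda>x::real. ln (ln x) \<ge> 1) at_top" by real_asymp
  qed (rule eventually_ge_at_top)
  then have ev: "eventually (\<lambda>k. (2::real) ^ k \<ge> 1 \<and> L (2 ^ k) \<ge> 1 \<and> L (2 ^ k) \<le> ln (ln (2 ^ k)) \<and> ln (ln ((2::real) ^ k)) \<ge> 1 \<and>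
      (l0 * (ln (ln (2 ^ k)) + 1) + 1) * ln (ln (2 ^ k)) \<le> 2 ^ k) sequentially"
    by (rule eventually_compose_filterlim[OF _ filterlim_pow2])
  then obtain k0 where k0: "\<And>k. k \<ge> k0 \<Longrightarrow> (2::real) ^ k \<ge> 1 \<and> L (2 ^ k) \<ge> 1 \<and> L (2 ^ k) \<le> ln (ln (2 ^ k)) \<and> ln (ln ((2::real) ^ k)) \<ge> 1 \<and>
      (l0 * (ln (ln (2 ^ k)) + 1) + 1) * ln (ln (2 ^ k)) \<le> 2 ^ k"
    by (auto simp: eventually_sequentially)
  define N :: "nat \<Rightarrow> nat" where "N k = 2 ^ (k + k0)" for k
  have rN: "real (N k) = 2 ^ (k + k0)" for k by (simp add: N_def)
  define z where "z k = (1 - \<epsilon>) * \<sigma> * sqrt (2 * (N k / L (N k)) * ln (ln (N k)))" for k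
  have window_le: "window (N k) \<le> N k" for k
  proof -
    have "N k / L (N k) \<le> N k / 1" unfolding rN using k0[of "k + k0"] by (intro divide_left_mono) auto
    then have "\<lfloor>N k / L (N k)\<rfloor> \<le> \<lfloor>real (N k)\<rfloor>" by (intro floor_mono) simp
    then show ?thesis by (simp add: window_def)
  qed
  have "AE \<omega> in M. \<exists>\<^sub>F k in sequentially. z k \<le> (\<Sum>j\<in>{N k<..N k + window (N k)}. X j \<omega>)"
  proof (rule borel_cantelli_indep)
    show "indep_vars (\<lambda>_. borel) (\<lambda>k \<omega>. \<Sum>j\<in>{N k<..N k + window (N k)}. X j \<omega>) UNIV"
    proof (rule indep_disjoint_blocks)
      have "{N i<..N i + window (N i)} \<inter> {N j<..N j + window (N j)} = {}" if "i < j" for i j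
      proof -
        have "N i + window (N i) \<le> 2 * N i" using window_le[of i] by simp
        also have "\<dots> = N (Suc i)" by (simp add: N_def)
        also have "\<dots> \<le> N j" unfolding N_def using that by (intro power_increasing) auto
        finally show ?thesis by auto
      qed
      then show "disjoint_family (\<lambda>k. {N k<..N k + window (N k)})"
        unfolding disjoint_family_on_def by (metis Int_commute linorder_neqE_nat)
    qed auto
    have lb: "exp (- K) * (1 / (k + k0 + 1)) \<le> tail (window (N k)) (z k)" for k
    proof -
      define x where "x = ln (ln (real (N k)))"
      define A where "A = real (N k) / L (N k)"
      have h: "L (N k) \<ge> 1" "L (N k) \<le> x" "x \<ge> 1" "(l0 * (x + 1) + 1) * x \<le> N k"
        using k0[of "k + k0"] by (auto simp: rN x_def)
      have A0: "A \<ge> 0" using h by (simp add: A_def)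
      have "l0 * (x + 1) + 1 \<le> real (N k) / x" using h by (simp add: pos_le_divide_eq)
      also have "\<dots> \<le> A" unfolding A_def using h by (intro divide_left_mono) auto
      finally have "l0 * (x + 1) + 1 \<le> A" .
      moreover have "A \<le> real (window (N k)) + 1" "window (N k) = nat \<lfloor>A\<rfloor>" using A0 by (auto simp: window_def A_def)
      ultimately have "exp (- K) * exp (- (1 - \<epsilon> / 2) * x) \<le> tail (window (N k)) ((1 - \<epsilon>) * \<sigma> * sqrt (2 * A * x))"
        using h by (intro td) linarith+
      also have "\<dots> = tail (window (N k)) (z k)" by (simp add: z_def A_def x_def)
      finally have 1: "exp (- K) * exp (- (1 - \<epsilon> / 2) * x) \<le> tail (window (N k)) (z k)" .
      have "1 / (k + k0 + 1) \<le> exp (- x)"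
      proof -
        have lN: "ln (real (N k)) = (k + k0) * ln 2" by (simp add: rN ln_realpow)
        have l0: "ln (real (N k)) \<ge> 0" unfolding rN by (intro ln_ge_zero) simp
        moreover have "ln (real (N k)) \<noteq> 0" using h by (auto simp: x_def)
        ultimately have ne: "ln (real (N k)) > 0" by simp
        have "exp x = ln (real (N k))" unfolding x_def using ne by simp
        also have "\<dots> \<le> real (k + k0) * 1" unfolding lN using ln_2_less_1 by (intro mult_left_mono) auto
        finally have "exp x \<le> k + k0 + 1" by simp
        then show ?thesis by (simp add: exp_minus field_simps)
      qed
      also have "\<dots> \<le> exp (- (1 - \<epsilon> / 2) * x)" using h \<epsilon> by (simp add: algebra_simps)
      finally have "exp (- K) * (1 / (k + k0 + 1)) \<le> exp (- K) * exp (- (1 - \<epsilon> / 2) * x)"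
        by (intro mult_left_mono) auto
      with 1 show ?thesis by simp
    qed
    show "\<not> summable (\<lambda>k. prob {\<omega> \<in> space M. z k \<le> (\<Sum>j\<in>{N k<..N k + window (N k)}. X j \<omega>)})"
      unfolding prob_block_sum
    proof
      assume "summable (\<lambda>k. tail (window (N k)) (z k))"
      then have "summable (\<lambda>k. exp (- K) * (1 / real (k + k0 + 1)))"
        using lb by (rule_tac summable_comparison_test'[where N = 0]) auto
      then have "summable (\<lambda>k. 1 / real (k + (k0 + 1)))"
        by (subst (asm) summable_cmult_iff) (simp add: add.assoc)
      then have "summable (\<lambda>k. 1 / real k)" using summable_iff_shift[of "\<lambda>k. 1 / real k" "k0 + 1"] by simp
      then show False using not_summable_harmonic[where 'a = real] by (simp add: inverse_eq_divide)
    qed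
  qed
  then show ?thesis
  proof eventually_elim
    case (elim \<omega>)
    show ?case unfolding frequently_sequentially
    proof
      fix m
      obtain k where k: "k \<ge> m" "z k \<le> (\<Sum>j\<in>{N k<..N k + window (N k)}. X j \<omega>)"
        using elim unfolding frequently_sequentially by blast
      have "k + k0 < N k" unfolding N_def by (rule less_exp)
      then show "\<exists>n\<ge>m. (1 - \<epsilon>) * \<sigma> * sqrt (2 * (real n / L (real n)) * ln (ln (real n))) \<le> (\<Sum>j\<in>{n<..n + window n}. X j \<omega>)"
        using k by (intro exI[of _ "N k"]) (auto simp: z_def)
    qed
  qed
qed

end

section \<open>The upper bound\<close>

context iid_seq
begin

text \<open>
  The maximal inequality with exponential parameter \<open>\<tau>\<close> times the optimal Gaussian value
  $q = \sqrt{2\ell/a}/\sigma$.  The choice of \<open>\<eta>\<close> makes $q b \le \epsilon / 10$, so that the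
  summands are small on the scale of $q$, and the hypothesis on $\rho(b)$ makes the mean negligible.
  The parameters \<open>z\<close>, \<open>\<theta>\<close>, \<open>\<tau>\<close> and the sign \<open>c\<close> allow two uses: for the main
  deviation, and for the small fluctuation inside a block.
\<close>

lemma trunc_block_tail:
  fixes n s :: nat and a A b c lam z \<epsilon> \<eta> \<theta> \<tau> :: real
  assumes \<epsilon>: "0 < \<epsilon>" and A: "A > 0" and lam: "lam > 0" and a: "A \<le> 4 * a" "a \<le> 4 * A"
    and \<eta>: "\<eta> = \<sigma> * \<epsilon> / 30" and b: "b = \<eta> * sqrt (A / lam)" and \<rho>: "\<rho> b \<le> \<eta>\<^sup>2 / 2"
    and \<tau>: "\<tau> > 0" and n: "n \<le> \<theta> * a" and c: "\<bar>c\<bar> = (1::real)"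
  shows "prob {\<omega> \<in> space M. \<exists>i\<le>n. z * \<sigma> * sqrt (2 * a * lam) \<le> (\<Sum>j\<in>{s<..s + i}. c * trunc b (X j \<omega>))}
    \<le> exp (lam * (- 2 * \<tau> * z + \<theta> * (\<tau> * \<epsilon> / 5 + \<tau>\<^sup>2 * exp (\<tau> * \<epsilon> / 10))))"
proof -
  have a0: "a > 0" using a A by simp
  have \<theta>: "\<theta> \<ge> 0"
  proof -
    have "0 \<le> \<theta> * a" using n by (rule order_trans[rotated]) simp
    then show ?thesis using a0 by (simp add: zero_le_mult_iff)
  qed
  have \<eta>0: "\<eta> > 0" unfolding \<eta> using \<sigma>_pos \<epsilon> by simp
  have b0: "b > 0" using b \<eta>0 A lam by simp
  define q where "q = sqrt (2 * lam / a) / \<sigma>"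
  have q0: "q > 0" using lam a0 \<sigma>_pos by (simp add: q_def)
  have q2: "q\<^sup>2 = 2 * lam / (a * \<sigma>\<^sup>2)" using lam a0 by (simp add: q_def power_divide)
  have b2: "b\<^sup>2 = \<eta>\<^sup>2 * (A / lam)" using lam A by (simp add: b power_mult_distrib)
  have qb: "q * b \<le> \<epsilon> / 10"
  proof (rule power2_le_imp_le)
    have "(q * b)\<^sup>2 = 2 * \<eta>\<^sup>2 / \<sigma>\<^sup>2 * (A / a)"
      using lam A a0 \<sigma>_pos by (simp add: power_mult_distrib q2 b2 field_simps)
    also have "\<dots> \<le> 2 * \<eta>\<^sup>2 / \<sigma>\<^sup>2 * 4" using a a0 by (intro mult_left_mono) (auto simp: field_simps)
    also have "\<dots> \<le> (\<epsilon> / 10)\<^sup>2" using \<sigma>_pos by (simp add: \<eta> power_mult_distrib power_divide)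
    finally show "(q * b)\<^sup>2 \<le> (\<epsilon> / 10)\<^sup>2" .
  qed (use \<epsilon> in simp)
  have qx: "q * (z * \<sigma> * sqrt (2 * a * lam)) = 2 * lam * z"
  proof -
    have "sqrt (2 * lam / a) * sqrt (2 * a * lam) = sqrt ((2 * lam)\<^sup>2)"
      using a0 by (simp add: real_sqrt_mult[symmetric] power2_eq_square)
    also have "\<dots> = 2 * lam" unfolding real_sqrt_abs using lam by simp
    finally show ?thesis using \<sigma>_pos by (simp add: q_def mult_ac)
  qed
  have mean: "n * (\<tau> * q * \<rho> b / b) \<le> lam * (\<theta> * (\<tau> * \<epsilon> / 5))"
  proof -
    have "q / b = (q * b) * lam / (\<eta>\<^sup>2 * A)"
    proof -
      have "q / b = (q * b) / b\<^sup>2" using b0 by (simp add: power2_eq_square)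
      then show ?thesis by (simp add: b2)
    qed
    also have "\<dots> \<le> (\<epsilon> / 10) * lam / (\<eta>\<^sup>2 * A)"
      using qb lam A by (intro divide_right_mono mult_right_mono) auto
    finally have qb': "q / b \<le> (\<epsilon> / 10) * lam / (\<eta>\<^sup>2 * A)" .
    have "q / b * \<rho> b \<le> ((\<epsilon> / 10) * lam / (\<eta>\<^sup>2 * A)) * (\<eta>\<^sup>2 / 2)"
      using qb' \<rho> \<rho>_nonneg[of b] \<epsilon> lam A by (intro mult_mono) auto
    also have "\<dots> = \<epsilon> * lam / (20 * A)" using \<eta>0 by simp
    finally have 1: "q / b * \<rho> b \<le> \<epsilon> * lam / (20 * A)" .
    have "n * (\<tau> * (q / b * \<rho> b)) \<le> (\<theta> * a) * (\<tau> * (\<epsilon> * lam / (20 * A)))"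
      using n 1 \<tau> \<theta> a0 q0 b0 \<rho>_nonneg[of b] by (intro mult_mono mult_left_mono) auto
    also have "\<dots> \<le> (\<theta> * (4 * A)) * (\<tau> * (\<epsilon> * lam / (20 * A)))"
      using a \<theta> \<tau> \<epsilon> lam A by (intro mult_right_mono mult_left_mono) auto
    also have "\<dots> = lam * (\<theta> * (\<tau> * \<epsilon> / 5))" using A by simp
    finally show ?thesis by (simp add: mult_ac)
  qed
  have vr: "n * ((\<tau> * q)\<^sup>2 * \<sigma>\<^sup>2 * exp (\<tau> * q * b) / 2) \<le> lam * (\<theta> * (\<tau>\<^sup>2 * exp (\<tau> * \<epsilon> / 10)))"
  proof -
    have e: "exp (\<tau> * q * b) \<le> exp (\<tau> * \<epsilon> / 10)"
      using mult_left_mono[OF qb, of \<tau>] \<tau> by (simp add: mult.assoc)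
    have "n * ((\<tau> * q)\<^sup>2 * \<sigma>\<^sup>2 * exp (\<tau> * q * b) / 2) \<le> (\<theta> * a) * ((\<tau> * q)\<^sup>2 * \<sigma>\<^sup>2 * exp (\<tau> * \<epsilon> / 10) / 2)"
      using n e \<theta> a0 by (intro mult_mono divide_right_mono mult_left_mono) auto
    also have "\<dots> = lam * (\<theta> * (\<tau>\<^sup>2 * exp (\<tau> * \<epsilon> / 10)))"
      using a0 \<sigma>_pos by (simp add: power_mult_distrib q2)
    finally show ?thesis .
  qed
  have "prob {\<omega> \<in> space M. \<exists>i\<le>n. z * \<sigma> * sqrt (2 * a * lam) \<le> (\<Sum>j\<in>{s<..s + i}. c * trunc b (X j \<omega>))}
    \<le> exp (- (\<tau> * q) * (z * \<sigma> * sqrt (2 * a * lam)) + n * (\<tau> * q * \<rho> b / b + (\<tau> * q)\<^sup>2 * \<sigma>\<^sup>2 * exp (\<tau> * q * b) / 2))"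
    using \<tau> q0 by (intro trunc_maximal_inequality b0 c) auto
  also have "\<dots> \<le> exp (lam * (- 2 * \<tau> * z + \<theta> * (\<tau> * \<epsilon> / 5 + \<tau>\<^sup>2 * exp (\<tau> * \<epsilon> / 10))))"
  proof -
    have "- (\<tau> * q) * (z * \<sigma> * sqrt (2 * a * lam)) = - \<tau> * (q * (z * \<sigma> * sqrt (2 * a * lam)))" by simp
    also have "\<dots> = lam * (- 2 * \<tau> * z)" unfolding qx by simp
    finally have "- (\<tau> * q) * (z * \<sigma> * sqrt (2 * a * lam)) = lam * (- 2 * \<tau> * z)" .
    with mean vr show ?thesis unfolding exp_le_cancel_iff distrib_left by linarith
  qed
  finally show ?thesis .
qed

text \<open>
  Of the two terms in the fourth-moment bound, the first is of order $N w / (a \ell^2) \le 4 w/\ell$ because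
  $N = A\,L \le 4 a \ell$, and the second is of order $w c / (b \ell^2)$ with $c/b \le \ell/\eta$.
\<close>

lemma mid_block_tail:
  fixes n s :: nat and a A b N Lam lam \<epsilon> \<eta> :: real
  assumes \<epsilon>: "0 < \<epsilon>" and N: "N > 0" and Lam: "Lam > 0" "Lam \<le> lam" and A: "A = N / Lam"
    and a: "A \<le> 4 * a" "a \<le> 4 * A"
    and \<eta>: "\<eta> = \<sigma> * \<epsilon> / 30" and b: "b = \<eta> * sqrt (A / lam)" and \<rho>: "\<rho> b \<le> \<eta>\<^sup>2 / 2"
    and n: "n \<le> 2 * a"
  shows "prob {\<omega> \<in> space M. \<epsilon> * \<sigma> * sqrt (2 * a * lam) \<le> (\<Sum>j\<in>{s<..s + n}. mid b (sqrt N) (X j \<omega>))}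
    \<le> 4 * (128 + 12 * \<sigma>\<^sup>2 / \<eta>) / (\<epsilon> ^ 4 * \<sigma> ^ 4) * w (sqrt N) / lam"
proof -
  have lam: "lam > 0" using Lam by simp
  have A0: "A > 0" using A N Lam by simp
  have a0: "a > 0" using a A0 by simp
  have \<eta>0: "\<eta> > 0" unfolding \<eta> using \<sigma>_pos \<epsilon> by simp
  have b0: "b > 0" using b \<eta>0 A0 lam by simp
  define x where "x = \<epsilon> * \<sigma> * sqrt (2 * a * lam)"
  define W where "W = w (sqrt N)"
  have W0: "W \<ge> 0" unfolding W_def using N by (intro w_nonneg) simp
  have x0: "x > 0" using \<epsilon> \<sigma>_pos a0 lam by (simp add: x_def)
  have sa: "a / sqrt A \<le> 2 * sqrt a"
  proof -
    have "sqrt a \<le> sqrt (4 * A)" using a by (intro real_sqrt_le_mono)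
    then have "sqrt a * sqrt a \<le> sqrt a * (2 * sqrt A)" using a0 by (intro mult_left_mono) (auto simp: real_sqrt_mult)
    then show ?thesis using A0 a0 by (simp add: pos_divide_le_eq mult_ac)
  qed
  have mean: "n * (\<rho> b / b) \<le> x / 2"
  proof -
    have "n * (\<rho> b / b) \<le> (2 * a) * ((\<eta>\<^sup>2 / 2) / b)"
      using n \<rho> b0 a0 \<rho>_nonneg[of b] by (intro mult_mono divide_right_mono) auto
    also have "\<dots> = \<eta> * sqrt lam * (a / sqrt A)"
      using \<eta>0 A0 lam by (simp add: b real_sqrt_divide power2_eq_square)
    also have "\<dots> \<le> \<eta> * sqrt lam * (2 * sqrt a)" using sa \<eta>0 lam by (intro mult_left_mono) auto
    also have "\<dots> = (\<sigma> * \<epsilon> / 15) * sqrt (a * lam)" by (simp add: \<eta> real_sqrt_mult)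
    also have "\<dots> \<le> (\<sigma> * \<epsilon> / 2) * sqrt (2 * a * lam)"
      using \<sigma>_pos \<epsilon> a0 lam by (intro mult_mono real_sqrt_le_mono) auto
    also have "\<dots> = x / 2" by (simp add: x_def)
    finally show ?thesis .
  qed
  have x4: "x ^ 4 = 4 * \<epsilon> ^ 4 * \<sigma> ^ 4 * a\<^sup>2 * lam\<^sup>2"
  proof -
    have "sqrt (2 * a * lam) ^ 4 = ((sqrt (2 * a * lam))\<^sup>2)\<^sup>2" by simp
    also have "(sqrt (2 * a * lam))\<^sup>2 = 2 * a * lam" using a0 lam by simp
    finally show ?thesis by (simp add: x_def power_mult_distrib)
  qed
  have cb: "sqrt N / b \<le> lam / \<eta>"
  proof -
    have "sqrt N / b = sqrt (Lam * lam) / \<eta>"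
      using N Lam lam \<eta>0 by (simp add: b A real_sqrt_divide real_sqrt_mult)
    also have "sqrt (Lam * lam) \<le> sqrt (lam * lam)" using Lam lam by (intro real_sqrt_le_mono mult_right_mono) auto
    finally show ?thesis using lam \<eta>0 by (simp add: divide_right_mono)
  qed
  have NA: "N \<le> 4 * a * lam"
  proof -
    have "N = A * Lam" using A Lam by simp
    also have "\<dots> \<le> (4 * a) * lam" using a Lam A0 a0 by (intro mult_mono) auto
    finally show ?thesis .
  qed
  have t1: "real n * (16 * ((sqrt N)\<^sup>2 * W)) \<le> 128 * a\<^sup>2 * lam * W"
  proof -
    have "real n * (16 * (N * W)) \<le> (2 * a) * (16 * ((4 * a * lam) * W))"
      using n NA W0 a0 N by (intro mult_mono) auto
    then show ?thesis using N by (simp add: power2_eq_square mult_ac)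
  qed
  have t2: "3 * (real n)\<^sup>2 * (\<sigma>\<^sup>2 * (W * sqrt N / b)) \<le> 12 * a\<^sup>2 * \<sigma>\<^sup>2 * W * lam / \<eta>"
  proof -
    have "(real n)\<^sup>2 \<le> (2 * a)\<^sup>2" using n by (intro power_mono) auto
    then have "3 * (real n)\<^sup>2 * (\<sigma>\<^sup>2 * (W * (sqrt N / b))) \<le> 3 * (2 * a)\<^sup>2 * (\<sigma>\<^sup>2 * (W * (lam / \<eta>)))"
      using cb W0 b0 N by (intro mult_mono mult_left_mono) auto
    then show ?thesis by (simp add: power_mult_distrib mult_ac)
  qed
  have "prob {\<omega> \<in> space M. x \<le> (\<Sum>j\<in>{s<..s + n}. mid b (sqrt N) (X j \<omega>))}
    \<le> 16 * (real n * (16 * ((sqrt N)\<^sup>2 * W)) + 3 * (real n)\<^sup>2 * (\<sigma>\<^sup>2 * (W * sqrt N / b))) / x ^ 4"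
    unfolding W_def using N by (intro mid_sum_tail b0 x0 mean) auto
  also have "\<dots> \<le> 16 * (128 * a\<^sup>2 * lam * W + 12 * a\<^sup>2 * \<sigma>\<^sup>2 * W * lam / \<eta>) / x ^ 4"
    using t1 t2 x0 by (intro divide_right_mono mult_left_mono add_mono) auto
  also have "16 * (128 * a\<^sup>2 * lam * W + 12 * a\<^sup>2 * \<sigma>\<^sup>2 * W * lam / \<eta>) = (16 * (128 + 12 * \<sigma>\<^sup>2 / \<eta>) * W) * (a\<^sup>2 * lam)"
    by (simp add: algebra_simps)
  also have "\<dots> / x ^ 4 = 4 * (128 + 12 * \<sigma>\<^sup>2 / \<eta>) / (\<epsilon> ^ 4 * \<sigma> ^ 4) * W / lam"
  proof -
    have "\<dots> / x ^ 4 = (16 * (128 + 12 * \<sigma>\<^sup>2 / \<eta>) * W) * (a\<^sup>2 * lam) / ((4 * \<epsilon> ^ 4 * \<sigma> ^ 4 * lam) * (a\<^sup>2 * lam))"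
      unfolding x4 by (simp add: power2_eq_square mult_ac)
    also have "\<dots> = (16 * (128 + 12 * \<sigma>\<^sup>2 / \<eta>) * W) / (4 * \<epsilon> ^ 4 * \<sigma> ^ 4 * lam)"
      using a0 lam by (intro mult_divide_mult_cancel_right) auto
    also have "\<dots> = 4 * (128 + 12 * \<sigma>\<^sup>2 / \<eta>) / (\<epsilon> ^ 4 * \<sigma> ^ 4) * W / lam"
    proof -
      have "16 * B * W / (4 * \<epsilon> ^ 4 * \<sigma> ^ 4 * lam) = 4 * B / (\<epsilon> ^ 4 * \<sigma> ^ 4) * W / lam" for B
        using \<epsilon> \<sigma>_pos lam by (simp add: field_simps)
      then show ?thesis .
    qed
    finally show ?thesis .
  qed
  finally show ?thesis by (simp add: x_def W_def)
qed

end

context iid_slow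
begin

text \<open>
  What holds at all large scales.  The lower truncation level $\eta\sqrt{N/(L \ell)}$ tends to
  infinity because $L \ell \le \ell^2$ is negligible against $N = 2^k$, so $\rho$ becomes small there.
\<close>

lemma scale_facts:
  assumes \<epsilon>: "0 < \<epsilon>" and \<delta>: "\<delta> > 0" and \<eta>: "\<eta> > 0"
  shows "eventually (\<lambda>k. 8 \<le> L (2 ^ k) \<and> L (2 ^ k) \<le> ln (ln (2 ^ k)) \<and> 1 \<le> \<delta> * (2 ^ k / L (2 ^ k)) \<and>
    \<rho> (\<eta> * sqrt (2 ^ k / L (2 ^ k) / ln (ln (2 ^ k)))) \<le> \<eta>\<^sup>2 / 2 \<and>
    (\<forall>x y. 2 ^ k / 2 \<le> x \<longrightarrow> x \<le> y \<longrightarrow> y \<le> 4 * 2 ^ k \<longrightarrow> L x \<le> L y \<and> L y \<le> (1 + \<epsilon>) * L x)) sequentially"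
proof -
  have f1: "filterlim (\<lambda>k. 2 ^ k / 2 :: real) at_top sequentially" by real_asymp
  have L8: "eventually (\<lambda>k. 8 \<le> L (2 ^ k)) sequentially"
    by (rule eventually_compose_filterlim[OF _ filterlim_pow2]) (use L_at_top in \<open>auto simp: filterlim_at_top\<close>)
  have Ll: "eventually (\<lambda>k. L (2 ^ k) \<le> ln (ln (2 ^ k))) sequentially"
    by (rule eventually_compose_filterlim[OF L_le_lnln filterlim_pow2])
  have osc: "eventually (\<lambda>k. \<forall>x y. 2 ^ k / 2 \<le> x \<longrightarrow> x \<le> y \<longrightarrow> y \<le> 8 * (2 ^ k / 2) \<longrightarrow> L x \<le> L y \<and> L y \<le> (1 + \<epsilon>) * L x) sequentially"
    by (rule eventually_compose_filterlim[OF L_nearly_constant[OF \<epsilon>] f1])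
  have g: "filterlim (\<lambda>k. (2::real) ^ k / (ln (ln (2 ^ k)) * ln (ln (2 ^ k)))) at_top sequentially" by real_asymp
  have ge: "eventually (\<lambda>k. 2 ^ k / (ln (ln (2 ^ k)) * ln (ln (2 ^ k))) \<le> 2 ^ k / L (2 ^ k) / ln (ln (2 ^ k))) sequentially"
    using L8 Ll
  proof eventually_elim
    case (elim k)
    then have "2 ^ k / (ln (ln (2 ^ k)) * ln (ln (2 ^ k))) \<le> 2 ^ k / (L (2 ^ k) * ln (ln (2 ^ k)))"
      by (intro divide_left_mono mult_right_mono mult_pos_pos) auto
    then show ?case by simp
  qed
  have At: "filterlim (\<lambda>k. 2 ^ k / L (2 ^ k) / ln (ln (2 ^ k))) at_top sequentially"
    by (rule filterlim_at_top_mono[OF g ge])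
  have d: "eventually (\<lambda>k. 1 \<le> \<delta> * (2 ^ k / L (2 ^ k))) sequentially"
  proof -
    have "eventually (\<lambda>k. 1 / \<delta> \<le> 2 ^ k / L (2 ^ k) / ln (ln (2 ^ k))) sequentially"
      using At by (auto simp: filterlim_at_top)
    then show ?thesis using L8 Ll
    proof eventually_elim
      case (elim k)
      have "2 ^ k / L (2 ^ k) / ln (ln (2 ^ k)) \<le> 2 ^ k / L (2 ^ k) / 1"
        using elim by (intro divide_left_mono) auto
      then have "1 / \<delta> \<le> 2 ^ k / L (2 ^ k)" using elim by simp
      then show ?case using \<delta> by (simp add: pos_divide_le_eq mult.commute)
    qed
  qed
  have "filterlim (\<lambda>k. \<eta> * sqrt (2 ^ k / L (2 ^ k) / ln (ln (2 ^ k)))) at_top sequentially"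
    by (rule filterlim_tendsto_pos_mult_at_top[OF tendsto_const \<eta>])
      (rule filterlim_compose[OF sqrt_at_top At])
  then have "((\<lambda>k. \<rho> (\<eta> * sqrt (2 ^ k / L (2 ^ k) / ln (ln (2 ^ k))))) \<longlongrightarrow> 0) sequentially"
    by (rule filterlim_compose[OF \<rho>_tendsto_0])
  then have "eventually (\<lambda>k. \<rho> (\<eta> * sqrt (2 ^ k / L (2 ^ k) / ln (ln (2 ^ k)))) < \<eta>\<^sup>2 / 2) sequentially"
    by (rule order_tendstoD(2)) (use \<eta> in simp)
  then show ?thesis using L8 Ll d osc by eventually_elim auto
qed

text \<open>
  Failure of the block that starts at \<open>s\<close> and has length \<open>h\<close>; \<open>a\<close> is the window length at \<open>s\<close>.
  Every window that starts in the block lies in a stretch of $\lfloor a \rfloor + 2h$ indices after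
  \<open>s\<close>: one \<open>h\<close> for the position of its start, one for the growth of the window length.
  Its sum is the difference of a partial sum up to the end of the window (first event) and one
  up to its start (second event), plus the middle part (third event).
\<close>

definition bad :: "real \<Rightarrow> real \<Rightarrow> real \<Rightarrow> real \<Rightarrow> real \<Rightarrow> nat \<Rightarrow> nat \<Rightarrow> 'a set" where
  "bad \<epsilon> lam b c a h s =
    {\<omega> \<in> space M. \<exists>i\<le>nat \<lfloor>a\<rfloor> + 2 * h. (1 + \<epsilon>) * \<sigma> * sqrt (2 * a * lam) \<le> (\<Sum>j\<in>{s<..s + i}. 1 * trunc b (X j \<omega>))} \<union>
    {\<omega> \<in> space M. \<exists>i\<le>h. \<epsilon> * \<sigma> * sqrt (2 * a * lam) \<le> (\<Sum>j\<in>{s<..s + i}. (- 1) * trunc b (X j \<omega>))} \<union>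
    {\<omega> \<in> space M. \<epsilon> * \<sigma> * sqrt (2 * a * lam) \<le> (\<Sum>j\<in>{s<..s + (nat \<lfloor>a\<rfloor> + 2 * h)}. mid b c (X j \<omega>))}"

lemma bad_sets: "bad \<epsilon> lam b c a h s \<in> sets M"
proof -
  have [measurable]: "(\<lambda>\<omega>. \<Sum>j\<in>{s<..s + (nat \<lfloor>a\<rfloor> + 2 * h)}. mid b c (X j \<omega>)) \<in> borel_measurable M"
    by (rule block_sum_meas) measurable
  show ?thesis unfolding bad_def by (intro sets.Un exceed_meas) measurable
qed

text \<open>
  The first event uses \<open>\<tau> = 1\<close> and \<open>\<theta> = 1 + \<epsilon>\<^sup>2 / 6\<close>.  The second concerns at most
  $\epsilon^2 a / 12$ summands, whose variance is so small that \<open>\<tau> = 2 / \<epsilon>\<close> compensates for the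
  factor \<open>\<epsilon>\<close> in the deviation.
\<close>

lemma prob_bad:
  fixes a A b N Lam lam \<epsilon> \<eta> \<delta> :: real and h s :: nat
  assumes \<epsilon>: "0 < \<epsilon>" "\<epsilon> \<le> 1" and N: "N > 0" and Lam: "Lam > 0" "Lam \<le> lam" and A: "A = N / Lam"
    and a: "A \<le> 4 * a" "a \<le> 4 * A"
    and \<eta>: "\<eta> = \<sigma> * \<epsilon> / 30" and b: "b = \<eta> * sqrt (A / lam)" and \<rho>: "\<rho> b \<le> \<eta>\<^sup>2 / 2"
    and h: "h \<le> \<epsilon>\<^sup>2 / 48 * A"
  shows "prob (bad \<epsilon> lam b (sqrt N) a h s) \<le>
    2 * exp (- (1 + \<epsilon>) * lam) + 4 * (128 + 12 * \<sigma>\<^sup>2 / \<eta>) / (\<epsilon> ^ 4 * \<sigma> ^ 4) * w (sqrt N) / lam"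
proof -
  have lam: "lam > 0" using Lam by simp
  have A0: "A > 0" using A N Lam by simp
  have a0: "a > 0" using a A0 by simp
  have e2: "\<epsilon>\<^sup>2 \<le> \<epsilon>" using \<epsilon> by (simp add: power2_eq_square mult_left_le)
  have h': "h \<le> \<epsilon>\<^sup>2 / 12 * a"
  proof -
    have "\<epsilon>\<^sup>2 / 48 * A \<le> \<epsilon>\<^sup>2 / 48 * (4 * a)" using a by (intro mult_left_mono) auto
    moreover have "\<epsilon>\<^sup>2 / 48 * (4 * a) = \<epsilon>\<^sup>2 / 12 * a" by simp
    ultimately show ?thesis using h by linarith
  qed
  have fl: "real (nat \<lfloor>a\<rfloor>) \<le> a" using a0 by simp
  have n1: "real (nat \<lfloor>a\<rfloor> + 2 * h) \<le> (1 + \<epsilon>\<^sup>2 / 6) * a" using fl h' by (simp add: algebra_simps)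
  have n2: "real (nat \<lfloor>a\<rfloor> + 2 * h) \<le> 2 * a"
  proof -
    have "(1 + \<epsilon>\<^sup>2 / 6) * a \<le> 2 * a" using e2 \<epsilon> a0 by (intro mult_right_mono) auto
    then show ?thesis using n1 by simp
  qed
  have ex: "exp y \<le> 1 + 2 * y" if "0 \<le> y" "y \<le> 1" for y :: real
  proof -
    have "y\<^sup>2 \<le> y" using that by (simp add: power2_eq_square mult_left_le)
    then show ?thesis using exp_bound[OF that] by simp
  qed
  have p1: "prob {\<omega> \<in> space M. \<exists>i\<le>nat \<lfloor>a\<rfloor> + 2 * h. (1 + \<epsilon>) * \<sigma> * sqrt (2 * a * lam) \<le> (\<Sum>j\<in>{s<..s + i}. 1 * trunc b (X j \<omega>))}
      \<le> exp (- (1 + \<epsilon>) * lam)"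
  proof -
    have "(1 + \<epsilon>\<^sup>2 / 6) * (1 * \<epsilon> / 5 + 1\<^sup>2 * exp (1 * \<epsilon> / 10)) \<le> (1 + \<epsilon> / 6) * (1 + 2 * \<epsilon> / 5)"
      using ex[of "\<epsilon> / 10"] \<epsilon> e2 by (intro mult_mono) auto
    also have "\<dots> = 1 + 17 / 30 * \<epsilon> + \<epsilon>\<^sup>2 / 15" by (simp add: power2_eq_square field_simps)
    also have "\<dots> \<le> 1 + \<epsilon>" using e2 \<epsilon> by linarith
    finally have "- 2 * 1 * (1 + \<epsilon>) + (1 + \<epsilon>\<^sup>2 / 6) * (1 * \<epsilon> / 5 + 1\<^sup>2 * exp (1 * \<epsilon> / 10)) \<le> - (1 + \<epsilon>)" by simp
    then have "lam * (- 2 * 1 * (1 + \<epsilon>) + (1 + \<epsilon>\<^sup>2 / 6) * (1 * \<epsilon> / 5 + 1\<^sup>2 * exp (1 * \<epsilon> / 10))) \<le> lam * (- (1 + \<epsilon>))"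
      using lam by (intro mult_left_mono) auto
    then show ?thesis
      by (intro order.trans[OF trunc_block_tail[OF \<epsilon>(1) A0 lam a \<eta> b \<rho> _ n1, of 1 1 "1 + \<epsilon>"]]) (auto simp: mult.commute)
  qed
  have p2: "prob {\<omega> \<in> space M. \<exists>i\<le>h. \<epsilon> * \<sigma> * sqrt (2 * a * lam) \<le> (\<Sum>j\<in>{s<..s + i}. (- 1) * trunc b (X j \<omega>))}
      \<le> exp (- (1 + \<epsilon>) * lam)"
  proof -
    have "\<epsilon>\<^sup>2 / 12 * (2 / \<epsilon> * \<epsilon> / 5 + (2 / \<epsilon>)\<^sup>2 * exp (2 / \<epsilon> * \<epsilon> / 10)) = \<epsilon>\<^sup>2 / 30 + exp (1 / 5) / 3"
      using \<epsilon> by (simp add: power_divide distrib_left)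
    also have "\<dots> \<le> 1 / 30 + (1 + 2 / 5) / 3"
      using ex[of "1 / 5"] e2 \<epsilon> by (intro add_mono) auto
    finally have "- 2 * (2 / \<epsilon>) * \<epsilon> + \<epsilon>\<^sup>2 / 12 * (2 / \<epsilon> * \<epsilon> / 5 + (2 / \<epsilon>)\<^sup>2 * exp (2 / \<epsilon> * \<epsilon> / 10)) \<le> - 4 + 1"
      using \<epsilon> by simp
    then have "- 2 * (2 / \<epsilon>) * \<epsilon> + \<epsilon>\<^sup>2 / 12 * (2 / \<epsilon> * \<epsilon> / 5 + (2 / \<epsilon>)\<^sup>2 * exp (2 / \<epsilon> * \<epsilon> / 10)) \<le> - (1 + \<epsilon>)"
      using \<epsilon> by simp
    then have "lam * (- 2 * (2 / \<epsilon>) * \<epsilon> + \<epsilon>\<^sup>2 / 12 * (2 / \<epsilon> * \<epsilon> / 5 + (2 / \<epsilon>)\<^sup>2 * exp (2 / \<epsilon> * \<epsilon> / 10))) \<le> lam * (- (1 + \<epsilon>))"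
      using lam by (intro mult_left_mono) auto
    then have "exp (lam * (- 2 * (2 / \<epsilon>) * \<epsilon> + \<epsilon>\<^sup>2 / 12 * (2 / \<epsilon> * \<epsilon> / 5 + (2 / \<epsilon>)\<^sup>2 * exp (2 / \<epsilon> * \<epsilon> / 10)))) \<le> exp (- (1 + \<epsilon>) * lam)"
      by (simp only: exp_le_cancel_iff mult.commute[of lam "- (1 + \<epsilon>)"])
    moreover have "2 / \<epsilon> > 0" "\<bar>- 1\<bar> = (1::real)" using \<epsilon> by auto
    ultimately show ?thesis
      using trunc_block_tail[OF \<epsilon>(1) A0 lam a \<eta> b \<rho> _ h', of "2 / \<epsilon>" "- 1" \<epsilon> s] by linarith
  qed
  have p3: "prob {\<omega> \<in> space M. \<epsilon> * \<sigma> * sqrt (2 * a * lam) \<le> (\<Sum>j\<in>{s<..s + (nat \<lfloor>a\<rfloor> + 2 * h)}. mid b (sqrt N) (X j \<omega>))}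
    \<le> 4 * (128 + 12 * \<sigma>\<^sup>2 / \<eta>) / (\<epsilon> ^ 4 * \<sigma> ^ 4) * w (sqrt N) / lam"
    by (rule mid_block_tail[OF \<epsilon>(1) N Lam A a \<eta> b \<rho> n2])
  have [measurable]: "(\<lambda>\<omega>. \<Sum>j\<in>{s<..s + (nat \<lfloor>a\<rfloor> + 2 * h)}. mid b (sqrt N) (X j \<omega>)) \<in> borel_measurable M"
    by (rule block_sum_meas) measurable
  have "prob (bad \<epsilon> lam b (sqrt N) a h s) \<le> exp (- (1 + \<epsilon>) * lam) + exp (- (1 + \<epsilon>) * lam)
      + 4 * (128 + 12 * \<sigma>\<^sup>2 / \<eta>) / (\<epsilon> ^ 4 * \<sigma> ^ 4) * w (sqrt N) / lam"
    unfolding bad_def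
    by (intro order.trans[OF measure_Un_le] add_mono p1 p2 p3 sets.Un exceed_meas) measurable
  then show ?thesis by simp
qed

lemma not_bad_imp_le:
  fixes a b c lam \<epsilon> :: real and h s n W :: nat
  assumes nb: "\<omega> \<notin> bad \<epsilon> lam b c a h s" "\<omega> \<in> space M"
    and s: "s \<le> n" "n \<le> s + h" and W: "n - s + W \<le> nat \<lfloor>a\<rfloor> + 2 * h"
    and X: "\<And>j. j \<in> {n<..n + W} \<Longrightarrow> \<bar>X j \<omega>\<bar> \<le> c"
  shows "(\<Sum>j\<in>{n<..n + W}. X j \<omega>) \<le> (1 + 3 * \<epsilon>) * \<sigma> * sqrt (2 * a * lam)"
proof -
  define Q where "Q = sqrt (2 * a * lam)"
  define T where "T i = (\<Sum>j\<in>{s<..s + i}. trunc b (X j \<omega>))" for i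
  have N: "\<not> (\<exists>i\<le>nat \<lfloor>a\<rfloor> + 2 * h. (1 + \<epsilon>) * \<sigma> * Q \<le> (\<Sum>j\<in>{s<..s + i}. 1 * trunc b (X j \<omega>)))"
    "\<not> (\<exists>i\<le>h. \<epsilon> * \<sigma> * Q \<le> (\<Sum>j\<in>{s<..s + i}. (- 1) * trunc b (X j \<omega>)))"
    "\<not> \<epsilon> * \<sigma> * Q \<le> (\<Sum>j\<in>{s<..s + (nat \<lfloor>a\<rfloor> + 2 * h)}. mid b c (X j \<omega>))"
    using nb unfolding bad_def Q_def by blast+
  have 1: "T i < (1 + \<epsilon>) * \<sigma> * Q" if "i \<le> nat \<lfloor>a\<rfloor> + 2 * h" for i
  proof -
    from N(1) that have "\<not> (1 + \<epsilon>) * \<sigma> * Q \<le> (\<Sum>j\<in>{s<..s + i}. 1 * trunc b (X j \<omega>))" by blast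
    then show ?thesis by (simp add: T_def)
  qed
  have 2: "- T i < \<epsilon> * \<sigma> * Q" if "i \<le> h" for i
  proof -
    from N(2) that have "\<not> \<epsilon> * \<sigma> * Q \<le> (\<Sum>j\<in>{s<..s + i}. (- 1) * trunc b (X j \<omega>))" by blast
    then show ?thesis by (simp add: T_def sum_negf)
  qed
  have 3: "(\<Sum>j\<in>{s<..s + (nat \<lfloor>a\<rfloor> + 2 * h)}. mid b c (X j \<omega>)) < \<epsilon> * \<sigma> * Q"
    using N(3) by simp
  have split: "T (n - s + W) = T (n - s) + (\<Sum>j\<in>{n<..n + W}. trunc b (X j \<omega>))"
  proof -
    have "{s<..s + (n - s + W)} = {s<..s + (n - s)} \<union> {n<..n + W}" using s by auto
    then show ?thesis unfolding T_def using s by (simp only:) (subst sum.union_disjoint, auto)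
  qed
  have "(\<Sum>j\<in>{n<..n + W}. X j \<omega>) \<le> (\<Sum>j\<in>{n<..n + W}. trunc b (X j \<omega>) + mid b c (X j \<omega>))"
    by (intro sum_mono le_trunc_plus_mid X)
  also have "\<dots> = (\<Sum>j\<in>{n<..n + W}. trunc b (X j \<omega>)) + (\<Sum>j\<in>{n<..n + W}. mid b c (X j \<omega>))"
    by (rule sum.distrib)
  also have "(\<Sum>j\<in>{n<..n + W}. mid b c (X j \<omega>)) \<le> (\<Sum>j\<in>{s<..s + (nat \<lfloor>a\<rfloor> + 2 * h)}. mid b c (X j \<omega>))"
    using s W by (intro sum_mono2) (auto simp: mid_def)
  also have "(\<Sum>j\<in>{n<..n + W}. trunc b (X j \<omega>)) = T (n - s + W) - T (n - s)" using split by simp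
  finally have "(\<Sum>j\<in>{n<..n + W}. X j \<omega>) \<le> (1 + \<epsilon>) * \<sigma> * Q + \<epsilon> * \<sigma> * Q + \<epsilon> * \<sigma> * Q"
    using 1[OF W] 2[of "n - s"] 3 s by linarith
  also have "\<dots> = (1 + 3 * \<epsilon>) * \<sigma> * Q" by (simp add: algebra_simps)
  finally show ?thesis by (simp add: Q_def)
qed

text \<open>
  The blocks at scale $k$ start at the multiples of $h_k = \lfloor \delta A_k \rfloor$ between
  $2^k/2$ and $2 \cdot 2^k$.  Starting half a scale early guarantees that the block
  containing $n$ is among them for every $n$ of the scale $2^k \le n < 2^{k+1}$.
\<close>

lemma AE_delayed_sum_le:
  assumes \<epsilon>: "0 < \<epsilon>" "\<epsilon> \<le> 1"
  shows "AE \<omega> in M. \<forall>\<^sub>F n in sequentially.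
    (\<Sum>j\<in>{n<..n + window n}. X j \<omega>) \<le> (1 + 3 * \<epsilon>) * (1 + \<epsilon>) * \<sigma> * sqrt (2 * (n / L n) * ln (ln n))"
proof -
  define \<delta> where "\<delta> = \<epsilon>\<^sup>2 / 48"
  define \<eta> where "\<eta> = \<sigma> * \<epsilon> / 30"
  have \<delta>0: "0 < \<delta>" and \<delta>1: "\<delta> \<le> 1" using \<epsilon> power_le_one[of \<epsilon> 2] by (auto simp: \<delta>_def)
  have \<eta>0: "\<eta> > 0" using \<epsilon> \<sigma>_pos by (simp add: \<eta>_def)
  define lam :: "nat \<Rightarrow> real" where "lam k = ln (ln (2 ^ k))" for k
  define A :: "nat \<Rightarrow> real" where "A k = 2 ^ k / L (2 ^ k)" for k
  define b where "b k = \<eta> * sqrt (A k / lam k)" for k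
  define h where "h k = nat \<lfloor>\<delta> * A k\<rfloor>" for k
  define U where "U k = {u. 2 ^ k / 2 \<le> real (u * h k) \<and> real (u * h k) \<le> 2 * 2 ^ k}" for k
  define B where "B k s = bad \<epsilon> (lam k) (b k) (sqrt (2 ^ k)) (real s / L (real s)) (h k) s" for k s
  define F where "F k = (\<Union>u\<in>U k. B k (u * h k))" for k
  define C where "C = 4 * (128 + 12 * \<sigma>\<^sup>2 / \<eta>) / (\<epsilon> ^ 4 * \<sigma> ^ 4)"
  have C0: "C \<ge> 0" using \<eta>0 \<epsilon> by (simp add: C_def)
  from scale_facts[OF \<epsilon>(1) \<delta>0 \<eta>0] obtain k0 where k0: "\<And>k. k \<ge> k0 \<Longrightarrow> 8 \<le> L (2 ^ k) \<and> L (2 ^ k) \<le> lam k \<and> 1 \<le> \<delta> * A k \<and>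
      \<rho> (b k) \<le> \<eta>\<^sup>2 / 2 \<and>
      (\<forall>x y. 2 ^ k / 2 \<le> x \<longrightarrow> x \<le> y \<longrightarrow> y \<le> 4 * 2 ^ k \<longrightarrow> L x \<le> L y \<and> L y \<le> (1 + \<epsilon>) * L x)"
    unfolding eventually_sequentially lam_def A_def b_def by blast
  have hk: "real (h k) \<le> \<delta> * A k" "\<delta> * A k \<le> 2 * real (h k)" "h k \<ge> 1" if "k \<ge> k0" for k
  proof -
    have "1 \<le> \<delta> * A k" using k0[OF that] by simp
    moreover from this have "real (nat \<lfloor>\<delta> * A k\<rfloor>) = of_int \<lfloor>\<delta> * A k\<rfloor>" "1 \<le> \<lfloor>\<delta> * A k\<rfloor>" by (simp_all add: le_floor_iff)
    ultimately show "real (h k) \<le> \<delta> * A k" "\<delta> * A k \<le> 2 * real (h k)" "h k \<ge> 1"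
      unfolding h_def by linarith+
  qed
  \<comment> \<open>the number of blocks is of order $2^k / (\delta A_k) = L(2^k) / \delta$\<close>
  have U_fin: "finite (U k)" and U_card: "real (card (U k)) \<le> 5 / \<delta> * lam k" if k: "k \<ge> k0" for k
  proof -
    note kk = k0[OF k]
    have hp: "real (h k) > 0" using hk(3)[OF k] by linarith
    have sub: "U k \<subseteq> {..nat \<lfloor>2 * 2 ^ k / real (h k)\<rfloor>}"
    proof
      fix u assume "u \<in> U k"
      then have "real u \<le> 2 * 2 ^ k / h k" using hp by (simp add: U_def pos_le_divide_eq)
      then show "u \<in> {..nat \<lfloor>2 * 2 ^ k / real (h k)\<rfloor>}" by (simp add: le_nat_floor)
    qed
    then show "finite (U k)" by (rule finite_subset) simp
    have "card (U k) \<le> nat \<lfloor>2 * 2 ^ k / real (h k)\<rfloor> + 1" using card_mono[OF _ sub] by simp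
    then have "real (card (U k)) \<le> real (nat \<lfloor>2 * 2 ^ k / real (h k)\<rfloor>) + 1" by linarith
    also have "real (nat \<lfloor>2 * 2 ^ k / real (h k)\<rfloor>) \<le> 2 * 2 ^ k / real (h k)" by simp
    also have "2 * 2 ^ k / real (h k) \<le> 2 * 2 ^ k / (\<delta> * A k / 2)"
      using hk[OF k] hp kk by (intro divide_left_mono mult_pos_pos) auto
    also have "\<dots> = 4 / \<delta> * L (2 ^ k)" by (simp add: A_def)
    also have "\<dots> \<le> 4 / \<delta> * lam k" using kk \<delta>0 by (intro mult_left_mono) auto
    also have "1 \<le> 1 / \<delta> * lam k"
    proof -
      have "1 * 1 \<le> 1 / \<delta> * lam k" using \<delta>0 \<delta>1 kk by (intro mult_mono) auto
      then show ?thesis by simp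
    qed
    finally show "real (card (U k)) \<le> 5 / \<delta> * lam k" by simp
  qed
  have B_sets: "B k s \<in> sets M" for k s unfolding B_def by (rule bad_sets)
  have L_near: "L (2 ^ k) \<le> 2 * L x" "L x \<le> 2 * L (2 ^ k)" if k: "k \<ge> k0" and x: "2 ^ k / 2 \<le> x" "x \<le> 4 * 2 ^ k" for k x
  proof -
    have osc: "L x' \<le> L y" "L y \<le> (1 + \<epsilon>) * L x'" if "2 ^ k / 2 \<le> x'" "x' \<le> y" "y \<le> 4 * 2 ^ k" for x' y
      using k0[OF k] that by auto
    have L8: "L (2 ^ k) \<ge> 8" using k0[OF k] by simp
    have le2: "u \<le> 2 * v" if "u \<le> (1 + \<epsilon>) * v" "v > 0" for u v
    proof -
      have "(1 + \<epsilon>) * v \<le> 2 * v" using \<epsilon> that by (intro mult_right_mono) auto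
      then show ?thesis using that by linarith
    qed
    have "L (2 ^ k) \<le> 2 * L x \<and> L x \<le> 2 * L (2 ^ k)"
    proof (cases "x \<le> 2 ^ k")
      case True
      have "L x \<le> L (2 ^ k)" "L (2 ^ k) \<le> (1 + \<epsilon>) * L x" using osc[of x "2 ^ k"] x True by auto
      moreover have "L x > 0"
      proof (rule ccontr)
        assume "\<not> L x > 0"
        then have "(1 + \<epsilon>) * L x \<le> 0" using \<epsilon> by (intro mult_nonneg_nonpos) auto
        then show False using \<open>L (2 ^ k) \<le> (1 + \<epsilon>) * L x\<close> L8 by simp
      qed
      ultimately show ?thesis using le2[of "L (2 ^ k)" "L x"] L8 by simp
    next
      case False
      then have "L (2 ^ k) \<le> L x" "L x \<le> (1 + \<epsilon>) * L (2 ^ k)" using osc[of "2 ^ k" x] x by auto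
      then show ?thesis using le2[of "L x" "L (2 ^ k)"] L8 by simp
    qed
    then show "L (2 ^ k) \<le> 2 * L x" "L x \<le> 2 * L (2 ^ k)" by auto
  qed
  have prob_B: "prob (B k s) \<le> 2 * exp (- (1 + \<epsilon>) * lam k) + C * w (sqrt (2 ^ k)) / lam k"
    if k: "k \<ge> k0" and s: "2 ^ k / 2 \<le> real s" "real s \<le> 2 * 2 ^ k" for k s
  proof -
    note kk = k0[OF k]
    have Ls: "L (2 ^ k) \<le> 2 * L s" "L s \<le> 2 * L (2 ^ k)" using L_near[OF k, of "real s"] s by auto
    have L0: "L (2 ^ k) > 0" "L s > 0" using Ls kk by auto
    show ?thesis unfolding B_def C_def
    proof (rule prob_bad[OF \<epsilon>, where Lam = "L (2 ^ k)" and A = "A k"])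
      have "A k = 4 * ((2 ^ k / 2) / (2 * L (2 ^ k)))" by (simp add: A_def)
      also have "\<dots> \<le> 4 * (s / L s)"
        using s Ls L0 by (intro mult_left_mono frac_le) auto
      finally show "A k \<le> 4 * (s / L s)" .
      have "s / L s \<le> (2 * 2 ^ k) / (L (2 ^ k) / 2)"
        using s Ls L0 by (intro frac_le) auto
      also have "\<dots> = 4 * A k" by (simp add: A_def)
      finally show "s / L s \<le> 4 * A k" .
      show "real (h k) \<le> \<epsilon>\<^sup>2 / 48 * A k" using hk(1)[OF k] by (simp add: \<delta>_def)
    qed (use kk in \<open>auto simp: A_def \<eta>_def b_def\<close>)
  qed
  have prob_F: "prob (F k) \<le> 10 / \<delta> * (lam k * exp (- (1 + \<epsilon>) * lam k)) + 5 * C / \<delta> * w (sqrt (2 ^ k))" if k: "k \<ge> k0" for k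
  proof -
    have l0: "lam k > 0" using k0[OF k] by simp
    have w0: "w (sqrt (2 ^ k)) \<ge> 0" by (intro w_nonneg) simp
    have "prob (F k) \<le> (\<Sum>u\<in>U k. prob (B k (u * h k)))"
      unfolding F_def by (intro finite_measure_subadditive_finite U_fin[OF k]) (auto intro: B_sets)
    also have "\<dots> \<le> (\<Sum>u\<in>U k. 2 * exp (- (1 + \<epsilon>) * lam k) + C * w (sqrt (2 ^ k)) / lam k)"
      by (intro sum_mono prob_B[OF k]) (auto simp: U_def)
    also have "\<dots> = real (card (U k)) * (2 * exp (- (1 + \<epsilon>) * lam k) + C * w (sqrt (2 ^ k)) / lam k)" by simp
    also have "\<dots> \<le> (5 / \<delta> * lam k) * (2 * exp (- (1 + \<epsilon>) * lam k) + C * w (sqrt (2 ^ k)) / lam k)"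
      using U_card[OF k] C0 w0 l0 by (intro mult_right_mono) auto
    also have "\<dots> = 10 / \<delta> * (lam k * exp (- (1 + \<epsilon>) * lam k)) + 5 * C / \<delta> * w (sqrt (2 ^ k))"
      using l0 by (simp add: distrib_left)
    finally show ?thesis .
  qed
  have F_sets: "F k \<in> sets M" if "k \<ge> k0" for k
    unfolding F_def by (intro sets.finite_UN U_fin[OF that] B_sets)
  have "AE \<omega> in M. eventually (\<lambda>k. \<omega> \<in> space M - F (k + k0)) sequentially"
  proof (rule borel_cantelli_AE1)
    have "summable (\<lambda>k. 10 / \<delta> * (lam k * exp (- (1 + \<epsilon>) * lam k)) + 5 * C / \<delta> * w (sqrt (2 ^ k)))"
      unfolding lam_def by (intro summable_add summable_mult summable_lnln \<epsilon> summable_w)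
    then have "summable (\<lambda>k. 10 / \<delta> * (lam (k + k0) * exp (- (1 + \<epsilon>) * lam (k + k0))) + 5 * C / \<delta> * w (sqrt (2 ^ (k + k0))))"
      by (subst summable_iff_shift)
    then show "summable (\<lambda>k. prob (F (k + k0)))"
    proof (rule summable_comparison_test'[where N = 0])
      show "norm (prob (F (k + k0))) \<le> 10 / \<delta> * (lam (k + k0) * exp (- (1 + \<epsilon>) * lam (k + k0))) + 5 * C / \<delta> * w (sqrt (2 ^ (k + k0)))" for k
        unfolding real_norm_def abs_of_nonneg[OF measure_nonneg] by (rule prob_F) simp
    qed
  qed (auto intro: F_sets simp: emeasure_eq_measure)
  with AE_eventually_small show ?thesis
  proof eventually_elim
    case (elim \<omega>)
    obtain i0 where i0: "\<And>i. i \<ge> i0 \<Longrightarrow> \<bar>X i \<omega>\<bar> \<le> sqrt i / 2"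
      using elim(1) by (auto simp: eventually_sequentially)
    obtain k1 where k1: "\<And>k. k \<ge> k1 \<Longrightarrow> \<omega> \<in> space M - F (k + k0)"
      using elim(2) by (auto simp: eventually_sequentially)
    show ?case unfolding eventually_sequentially
    proof (intro exI allI impI)
      fix n :: nat assume n: "n \<ge> max (max 1 i0) (2 ^ (k0 + k1))"
      obtain k where k: "2 ^ k \<le> n" "n < 2 ^ Suc k"
        using ex_power_ivl1[of 2 n] n by auto
      have "2 ^ (k0 + k1) < (2::nat) ^ Suc k" using n k by linarith
      then have "k0 + k1 < Suc k" by (rule power_less_imp_less_exp[rotated]) simp
      then have kk: "k \<ge> k0" "k - k0 \<ge> k1" by auto
      note kf = k0[OF kk(1)]
      have nF: "\<omega> \<notin> F k" "\<omega> \<in> space M" using k1[OF kk(2)] kk by auto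
      have nr: "2 ^ k \<le> real n" "real n < 2 * 2 ^ k"
      proof -
        have "real (2 ^ k) \<le> real n" using k(1) by (simp only: of_nat_le_iff)
        then show "2 ^ k \<le> real n" by simp
        have "real n < real (2 ^ Suc k)" using k(2) by (simp only: of_nat_less_iff)
        then show "real n < 2 * 2 ^ k" by simp
      qed
      define s where "s = (n div h k) * h k"
      have hp: "h k > 0" using hk(3)[OF kk(1)] by simp
      have s: "s \<le> n" "n < s + h k"
        using hp div_mult_mod_eq[of n "h k"] mod_less_divisor[OF hp, of n] unfolding s_def by linarith+
      have h_small: "real (h k) \<le> 2 ^ k / 2"
      proof -
        have "\<delta> * A k \<le> 1 * (2 ^ k / 8)"
          unfolding A_def using \<delta>0 \<delta>1 kf by (intro mult_mono divide_left_mono) auto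
        then show ?thesis using hk(1)[OF kk(1)] zero_le_power[of "2::real" k] by linarith
      qed
      have sr: "2 ^ k / 2 \<le> real s" "real s \<le> 2 * 2 ^ k" "real s \<le> real n"
        using s nr h_small by linarith+
      have "n div h k \<in> U k" using sr by (simp add: U_def s_def)
      then have nB: "\<omega> \<notin> B k s" using nF by (auto simp: F_def s_def)
      have osc: "L s \<le> L n" "L n \<le> (1 + \<epsilon>) * L s" using kf sr nr by auto
      have Ls: "L (2 ^ k) \<le> 2 * L s" using L_near(1)[OF kk(1), of "real s"] sr by simp
      have L4: "L s \<ge> 4" "L n \<ge> 4" using Ls kf osc by auto
      define a where "a = real s / L (real s)"
      have a0: "a \<ge> 0" using L4 by (simp add: a_def)
      \<comment> \<open>the window length grows by at most \<open>h k\<close> within a block, as \<open>L\<close> is increasing and at least 1\<close>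
      have anle: "n / L n \<le> a + h k"
      proof -
        have "n / L n \<le> n / L s" using osc L4 by (intro divide_left_mono) auto
        also have "\<dots> = a + (real n - s) / L s" using L4 by (simp add: a_def diff_divide_distrib)
        also have "\<dots> \<le> a + (real n - s) / 1" using L4 s by (intro add_left_mono divide_left_mono) auto
        finally have "n / L n \<le> a + (real n - s)" by simp
        moreover have "real n - real s \<le> real (h k)" using s by linarith
        ultimately show ?thesis by linarith
      qed
      have W1: "window n \<le> nat \<lfloor>a\<rfloor> + h k"
      proof -
        have "\<lfloor>n / L n\<rfloor> \<le> \<lfloor>a + real (h k)\<rfloor>" using anle by (intro floor_mono)
        also have "\<dots> = \<lfloor>a\<rfloor> + int (h k)" by (simp add: floor_add_int[symmetric])
        finally show ?thesis using a0 unfolding window_def by linarith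
      qed
      have Wn: "window n \<le> n"
      proof -
        have "n / L n \<le> n / 1" using L4 by (intro divide_left_mono) auto
        then have "\<lfloor>n / L n\<rfloor> \<le> \<lfloor>real n\<rfloor>" by (intro floor_mono) simp
        then show ?thesis by (simp add: window_def)
      qed
      have "(\<Sum>j\<in>{n<..n + window n}. X j \<omega>) \<le> (1 + 3 * \<epsilon>) * \<sigma> * sqrt (2 * a * lam k)"
      proof (rule not_bad_imp_le[OF nB[unfolded B_def, folded a_def] nF(2)])
        show "n - s + window n \<le> nat \<lfloor>a\<rfloor> + 2 * h k" using s W1 by linarith
        fix j assume j: "j \<in> {n<..n + window n}"
        have "\<bar>X j \<omega>\<bar> \<le> sqrt j / 2" using j n by (intro i0) auto
        also have "sqrt j \<le> sqrt (4 * 2 ^ k)"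
        proof (rule real_sqrt_le_mono)
          have "j \<le> 2 * n" using j Wn by auto
          then have "real j \<le> 2 * real n" by linarith
          then show "real j \<le> 4 * 2 ^ k" using nr by simp
        qed
        finally show "\<bar>X j \<omega>\<bar> \<le> sqrt (2 ^ k)" by (simp add: real_sqrt_mult)
      qed (use s in auto)
      also have "\<dots> \<le> (1 + 3 * \<epsilon>) * \<sigma> * ((1 + \<epsilon>) * sqrt (2 * (n / L n) * ln (ln n)))"
      proof (rule mult_left_mono)
        have "a \<le> (1 + \<epsilon>) * (n / L n)"
        proof -
          have "a \<le> n / L s" unfolding a_def using sr L4 by (intro divide_right_mono) auto
          also have "\<dots> \<le> n / (L n / (1 + \<epsilon>))"
            using osc L4 \<epsilon> by (intro divide_left_mono) (auto simp: pos_divide_le_eq mult.commute)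
          finally show ?thesis by (simp add: mult.commute)
        qed
        moreover have "lam k \<le> ln (ln n)"
        proof -
          have "ln (2 ^ k :: real) > 0"
          proof -
            have "lam k > 0" using kf by simp
            then have "ln (2 ^ k :: real) \<noteq> 0" by (auto simp: lam_def)
            moreover have "ln (2 ^ k :: real) \<ge> 0" by (intro ln_ge_zero) simp
            ultimately show ?thesis by linarith
          qed
          then show ?thesis unfolding lam_def using nr by (intro ln_mono) auto
        qed
        ultimately have "a * lam k \<le> ((1 + \<epsilon>) * (n / L n)) * ln (ln n)"
          using a0 L4 \<epsilon> kf by (intro mult_mono) auto
        also have "\<dots> \<le> (1 + \<epsilon>)\<^sup>2 * (n / L n) * ln (ln n)"
        proof -
          have "0 \<le> ln (ln (real n))" using \<open>lam k \<le> ln (ln n)\<close> kf by simp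
          moreover have "1 + \<epsilon> \<le> (1 + \<epsilon>)\<^sup>2" using \<epsilon> by (simp add: power2_eq_square)
          ultimately show ?thesis using L4 by (intro mult_right_mono) auto
        qed
        finally have "2 * (a * lam k) \<le> 2 * ((1 + \<epsilon>)\<^sup>2 * (n / L n) * ln (ln n))"
          by (rule mult_left_mono) simp
        then have "2 * a * lam k \<le> (1 + \<epsilon>)\<^sup>2 * (2 * (n / L n) * ln (ln n))" by (simp only: mult_ac)
        then have "sqrt (2 * a * lam k) \<le> sqrt ((1 + \<epsilon>)\<^sup>2 * (2 * (n / L n) * ln (ln n)))"
          by (rule real_sqrt_le_mono)
        also have "\<dots> = (1 + \<epsilon>) * sqrt (2 * (n / L n) * ln (ln n))"
          using \<epsilon> by (simp only: real_sqrt_mult[of "(1 + \<epsilon>)\<^sup>2"]) simp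
        finally show "sqrt (2 * a * lam k) \<le> (1 + \<epsilon>) * sqrt (2 * (n / L n) * ln (ln n))" .
      qed (use \<epsilon> \<sigma>_pos in auto)
      finally show "(\<Sum>j\<in>{n<..n + window n}. X j \<omega>) \<le> (1 + 3 * \<epsilon>) * (1 + \<epsilon>) * \<sigma> * sqrt (2 * (real n / L (real n)) * ln (ln (real n)))"
        by (simp add: mult_ac)
    qed
  qed
qed

end

section \<open>The law for delayed sums\<close>

context iid_slow
begin

text \<open>
  Outside one null set both bounds hold for all $\epsilon$ of a sequence that tends to 0.
\<close>

theorem limsup_delayed_sum:
  "AE \<omega> in M. limsup (\<lambda>n. ereal ((\<Sum>j\<in>{n<..n + window n}. X j \<omega>) / sqrt (2 * (n / L n) * ln (ln n)))) = ereal \<sigma>"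
proof -
  define Q :: "nat \<Rightarrow> real" where "Q n = sqrt (2 * (n / L n) * ln (ln n))" for n
  have Qpos: "eventually (\<lambda>n. Q n > 0) sequentially"
  proof -
    have "eventually (\<lambda>x::real. L x > 0 \<and> ln (ln x) > 0 \<and> x > 0) at_top"
    proof (intro eventually_conj)
      show "eventually (\<lambda>x. L x > 0) at_top" using L_at_top by (auto simp: filterlim_at_top_dense)
      show "eventually (\<lambda>x::real. ln (ln x) > 0) at_top" by real_asymp
    qed (rule eventually_gt_at_top)
    then have "eventually (\<lambda>n. L (real n) > 0 \<and> ln (ln (real n)) > 0 \<and> real n > 0) sequentially"
      by (rule eventually_compose_filterlim[OF _ filterlim_real_sequentially])
    then show ?thesis by eventually_elim (simp add: Q_def)
  qed
  have up: "AE \<omega> in M. \<forall>i::nat. \<forall>\<^sub>F n in sequentially.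
      (\<Sum>j\<in>{n<..n + window n}. X j \<omega>) \<le> (1 + 3 * (1 / Suc i)) * (1 + 1 / Suc i) * \<sigma> * Q n"
    unfolding AE_all_countable Q_def by (intro allI AE_delayed_sum_le) auto
  have lo: "AE \<omega> in M. \<forall>i::nat. \<exists>\<^sub>F n in sequentially.
      (1 - 1 / (Suc (Suc i))) * \<sigma> * Q n \<le> (\<Sum>j\<in>{n<..n + window n}. X j \<omega>)"
    unfolding AE_all_countable Q_def by (intro allI delayed_sum_frequently_ge) auto
  from up lo show ?thesis
  proof eventually_elim
    case (elim \<omega>)
    define r where "r n = (\<Sum>j\<in>{n<..n + window n}. X j \<omega>) / Q n" for n
    have "limsup (\<lambda>n. ereal (r n)) \<le> ereal \<sigma>"
    proof (rule LIMSEQ_le_const)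
      show "(\<lambda>i. ereal ((1 + 3 * (1 / Suc i)) * (1 + 1 / Suc i) * \<sigma>)) \<longlonglongrightarrow> ereal \<sigma>"
        unfolding lim_ereal by real_asymp
      have "limsup (\<lambda>n. ereal (r n)) \<le> ereal ((1 + 3 * (1 / Suc i)) * (1 + 1 / Suc i) * \<sigma>)" for i
      proof (rule Limsup_bounded)
        from elim(1) have "\<forall>\<^sub>F n in sequentially. (\<Sum>j\<in>{n<..n + window n}. X j \<omega>) \<le> (1 + 3 * (1 / Suc i)) * (1 + 1 / Suc i) * \<sigma> * Q n" ..
        then show "\<forall>\<^sub>F n in sequentially. ereal (r n) \<le> ereal ((1 + 3 * (1 / Suc i)) * (1 + 1 / Suc i) * \<sigma>)"
          using Qpos by eventually_elim (simp add: r_def pos_divide_le_eq)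
      qed
      then show "\<exists>N. \<forall>i\<ge>N. limsup (\<lambda>n. ereal (r n)) \<le> ereal ((1 + 3 * (1 / Suc i)) * (1 + 1 / Suc i) * \<sigma>)" by blast
    qed
    moreover have "ereal \<sigma> \<le> limsup (\<lambda>n. ereal (r n))"
    proof (rule LIMSEQ_le_const2)
      show "(\<lambda>i. ereal ((1 - 1 / Suc (Suc i)) * \<sigma>)) \<longlonglongrightarrow> ereal \<sigma>"
        unfolding lim_ereal by real_asymp
      have "ereal ((1 - 1 / Suc (Suc i)) * \<sigma>) \<le> limsup (\<lambda>n. ereal (r n))" for i
      proof (rule ccontr)
        assume "\<not> ereal ((1 - 1 / Suc (Suc i)) * \<sigma>) \<le> limsup (\<lambda>n. ereal (r n))"
        then have "limsup (\<lambda>n. ereal (r n)) < ereal ((1 - 1 / Suc (Suc i)) * \<sigma>)" by simp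
        from Limsup_lessD[OF this] have "\<forall>\<^sub>F n in sequentially. \<not> (1 - 1 / Suc (Suc i)) * \<sigma> * Q n \<le> (\<Sum>j\<in>{n<..n + window n}. X j \<omega>)"
          using Qpos by eventually_elim (simp add: r_def pos_divide_less_eq not_le)
        moreover from elim(2) have "\<exists>\<^sub>F n in sequentially. (1 - 1 / Suc (Suc i)) * \<sigma> * Q n \<le> (\<Sum>j\<in>{n<..n + window n}. X j \<omega>)" ..
        ultimately show False by (simp add: frequently_def)
      qed
      then show "\<exists>N. \<forall>i\<ge>N. ereal ((1 - 1 / Suc (Suc i)) * \<sigma>) \<le> limsup (\<lambda>n. ereal (r n))" by blast
    qed
    ultimately show ?case by (simp add: r_def Q_def)
  qed
qed

end

text \<open>
  For \<open>\<sigma> = 0\<close>: all quotients vanish almost surely, also those with a zero denominator.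
\<close>

lemma iid_copies_AE_zero:
  assumes "prob_space M" "iid_copies M Y X" "AE \<omega> in M. Y \<omega> = 0"
  shows "AE \<omega> in M. \<forall>j\<ge>1. X j \<omega> = 0"
proof -
  interpret prob_space M by fact
  have Y[measurable]: "Y \<in> borel_measurable M" and X: "indep_vars (\<lambda>_. borel) X {1..}"
    and d: "\<And>j. j \<ge> 1 \<Longrightarrow> distr M borel (X j) = distr M borel Y"
    using assms(2) by (auto simp: iid_copies_def)
  have D: "AE x in distr M borel (X j). x = 0" if "j \<ge> 1" for j
    unfolding d[OF that] using assms(3) by (subst AE_distr_iff) auto
  have "AE \<omega> in M. X j \<omega> = 0" if "j \<ge> 1" for j
  proof -
    have [measurable]: "X j \<in> borel_measurable M" using X that by (auto simp: indep_vars_def2)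
    show ?thesis using D[OF that] by (subst (asm) AE_distr_iff) auto
  qed
  then show ?thesis by (simp add: AE_all_countable)
qed

lemma iid_copies_imp_iid_seq:
  assumes "prob_space M" "iid_copies M Y X" "integrable M (\<lambda>\<omega>. (Y \<omega>)\<^sup>2)"
    "prob_space.expectation M Y = 0" "prob_space.expectation M (\<lambda>\<omega>. (Y \<omega>)\<^sup>2) = \<sigma>\<^sup>2" "\<sigma> > 0"
  shows "iid_seq M X (distr M borel Y) \<sigma>"
proof -
  interpret prob_space M by fact
  have [measurable]: "Y \<in> borel_measurable M" using assms(2) by (auto simp: iid_copies_def)
  show ?thesis
    using assms by unfold_locales (auto simp: iid_copies_def integrable_distr_eq integral_distr)
qed

theorem corollary2p2:
  fixes M :: "'a measure" and Y :: "'a \<Rightarrow> real" and X :: "nat \<Rightarrow> 'a \<Rightarrow> real"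
    and \<sigma> :: real and m :: nat
  assumes "prob_space M"
    and "iid_copies M Y X"
    and "integrable M Y" and "prob_space.expectation M Y = 0"
    and "integrable M (\<lambda>\<omega>. (Y \<omega> - prob_space.expectation M Y)\<^sup>2)"
    and "\<sigma> \<ge> 0" and "\<sigma>\<^sup>2 = prob_space.variance M Y"
    and "m \<ge> 2"
  shows "AE \<omega> in M.
    limsup (\<lambda>n. ereal
      (delayed_sum X n (n + nat \<lfloor>real n / iter_log m (real n)\<rfloor>) \<omega>
        / sqrt (2 * (real n / iter_log m (real n)) * ln (ln (real n))))) = ereal \<sigma>"
proof -
  have ds: "delayed_sum X n N \<omega> = (\<Sum>j\<in>{n<..N}. X j \<omega>)" for n N \<omega>
    unfolding delayed_sum_def by (intro sum.cong) auto
  have sq: "integrable M (\<lambda>\<omega>. (Y \<omega>)\<^sup>2)" and var: "\<sigma>\<^sup>2 = prob_space.expectation M (\<lambda>\<omega>. (Y \<omega>)\<^sup>2)"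
    using assms(5,7) unfolding assms(4) by simp_all
  show ?thesis
  proof (cases "\<sigma> = 0")
    case True
    have "AE \<omega> in M. (Y \<omega>)\<^sup>2 = 0"
      using var True integral_nonneg_eq_0_iff_AE[OF sq] by simp
    then have "AE \<omega> in M. Y \<omega> = 0" by simp
    from iid_copies_AE_zero[OF assms(1,2) this] show ?thesis
    proof eventually_elim
      case (elim \<omega>)
      then have "delayed_sum X n N \<omega> = 0" for n N unfolding ds by (intro sum.neutral) auto
      then show ?case using True by (simp add: Limsup_const)
    qed
  next
    case False
    with \<open>\<sigma> \<ge> 0\<close> have "\<sigma> > 0" by simp
    interpret iid_slow M X "distr M borel Y" \<sigma> "iter_log m"
      unfolding iid_slow_def
      using iid_copies_imp_iid_seq[OF assms(1,2) sq assms(4) var[symmetric] \<open>\<sigma> > 0\<close>] slow_scale_iter_log[OF \<open>m \<ge> 2\<close>]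
      by simp
    show ?thesis using limsup_delayed_sum unfolding ds window_def .
  qed
qed

end
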